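(* Let $A$ be a unimodular integer $d\times d$ matrix and let $F_A:\mathbb{T}^d\to\mathbb{T}^d$, $x\mapsto Ax \bmod 1$, be the toral automorphism determined by $A$. Let $\lambda_i$, $i=1,\dots,d$, be the eigenvalues of $A$. Then for every $\omega\ge0$ and every $z\in\mathbb{T}^d$, the translocal entropy of $F_A$ at $z$ is $$h_\omega(z)=\sum_{i:\ \log|\lambda_i|\ge\omega}\big(\log|\lambda_i|-\omega\big).$$
   Context: $\mathbb{T}^d=\mathbb{R}^d/\mathbb{Z}^d$ with its usual flat metric; unimodular means $\det A=\pm1$; the eigenvalues $\lambda_1,\dots,\lambda_d$ are listed with algebraic multiplicity. For a continuous map $f:X\to X$ of a compact metric space $(X,d)$, a set $E\subset X$ is $(n,\varepsilon)$-separated if for all distinct $x,y\in E$ there is $0\le j<n$ with $d(f^j(x),f^j(y))>\varepsilon$. For closed $K\subset X$, $S(n,\varepsilon,K)$ denotes the maximal cardinality of an $(n,\varepsilon)$-separated subset of $K$. For $\omega\ge0$ and $z\in X$, the upper translocal entropy at $z$ is $$\overline h_\omega(z)=\lim_{\varepsilon\to0}\limsup_{n\to\infty}\frac1n\log S\big(n,\varepsilon,\overline{B(z,e^{-\omega n})}\big),$$ and the lower translocal entropy $\underline h_\omega(z)$ is the same with $\liminf_{n\to\infty}$ in place of $\limsup_{n\to\infty}$. If the two coincide, their common value is the translocal entropy $h_\omega(z)$ (so an assertion about $h_\omega(z)$ includes that $\overline h_\omega(z)=\underline h_\omega(z)$). *)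

theory Defs
  imports "HOL-Analysis.Analysis" "HOL-Computational_Algebra.Polynomial"
begin

definition int_translate :: "real ^ 'n \<Rightarrow> real ^ 'n \<Rightarrow> bool" where
  "int_translate x y \<longleftrightarrow> (\<forall>i. x $ i - y $ i \<in> \<int>)"

lemma equivp_int_translate: "equivp (int_translate :: real ^ 'n \<Rightarrow> real ^ 'n \<Rightarrow> bool)"
proof (rule equivpI)
  show "reflp (int_translate :: real ^ 'n \<Rightarrow> real ^ 'n \<Rightarrow> bool)"
    by (simp add: reflp_def int_translate_def)
  show "symp (int_translate :: real ^ 'n \<Rightarrow> real ^ 'n \<Rightarrow> bool)"
    unfolding symp_def int_translate_def by (metis Ints_minus minus_diff_eq)
  show "transp (int_translate :: real ^ 'n \<Rightarrow> real ^ 'n \<Rightarrow> bool)"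
  proof (rule transpI)
    fix x y z :: "real ^ 'n"
    assume "int_translate x y" "int_translate y z"
    then have "(x $ i - y $ i) + (y $ i - z $ i) \<in> \<int>" for i
      by (intro Ints_add) (auto simp: int_translate_def)
    then show "int_translate x z" by (simp add: int_translate_def)
  qed
qed

quotient_type 'n torus = "real ^ 'n" / int_translate
  by (rule equivp_int_translate)

abbreviation torus_of :: "real ^ 'n \<Rightarrow> 'n torus" where
  "torus_of \<equiv> abs_torus"

lemma torus_of_eq_iff: "torus_of x = torus_of y \<longleftrightarrow> int_translate x y"
  by (rule torus.abs_eq_iff)

lemma torus_of_surj: "\<exists>x. torus_of x = p"
  by (metis Quotient_torus Quotient_abs_rep)

lemma torus_of_add_eq:
  assumes "torus_of x = torus_of y"
  shows "torus_of (w + (x - y)) = torus_of w"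
  using assms by (simp add: torus_of_eq_iff int_translate_def)

instantiation torus :: (finite) metric_space
begin

text \<open>The flat metric is the quotient metric: the infimum of the Euclidean distances between lifts.\<close>

definition dist_torus :: "'a torus \<Rightarrow> 'a torus \<Rightarrow> real" where
  "dist_torus p q = Inf {dist x y |x y. torus_of x = p \<and> torus_of y = q}"

definition uniformity_torus :: "('a torus \<times> 'a torus) filter" where
  "uniformity_torus = (INF e\<in>{0<..}. principal {(x, y). dist x y < e})"

definition open_torus :: "'a torus set \<Rightarrow> bool" where
  "open_torus U \<longleftrightarrow> (\<forall>x\<in>U. eventually (\<lambda>(x', y). x' = x \<longrightarrow> y \<in> U) uniformity)"

instance
proof
  show "uniformity = (INF e\<in>{0<..}. principal {(x, y :: 'a torus). dist x y < e})"
    by (rule uniformity_torus_def)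
  show "open U \<longleftrightarrow> (\<forall>x\<in>U. \<forall>\<^sub>F (x', y) in uniformity. x' = x \<longrightarrow> y \<in> U)" for U :: "'a torus set"
    by (rule open_torus_def)
next
  define D where "D p q = {dist x y |x y. torus_of x = p \<and> torus_of y = q}" for p q :: "'a torus"
  have D_bdd: "bdd_below (D p q)" for p q
    by (rule bdd_belowI[of _ 0]) (auto simp: D_def)
  have D_ne: "D p q \<noteq> {}" for p q
    using torus_of_surj[of p] torus_of_surj[of q] by (auto simp: D_def)
  have dist_D: "dist p q = Inf (D p q)" for p q :: "'a torus"
    by (simp add: dist_torus_def D_def)
  have nonneg: "0 \<le> dist p q" for p q :: "'a torus"
    unfolding dist_D by (rule cInf_greatest[OF D_ne]) (auto simp: D_def)
  fix p q r :: "'a torus"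
  show "dist p q = 0 \<longleftrightarrow> p = q"
  proof
    assume "p = q"
    obtain x where "torus_of x = p" using torus_of_surj by blast
    with \<open>p = q\<close> have "0 \<in> D p q" by (force simp: D_def)
    then have "dist p q \<le> 0" unfolding dist_D by (rule cInf_lower[OF _ D_bdd])
    with nonneg[of p q] show "dist p q = 0" by simp
  next
    assume 0: "dist p q = 0"
    obtain x y where xy: "torus_of x = p" "torus_of y = q" using torus_of_surj by blast
    show "p = q"
    proof (rule ccontr)
      assume "p \<noteq> q"
      then obtain i where i: "x $ i - y $ i \<notin> \<int>"
        using xy torus_of_eq_iff int_translate_def by metis
      define t where "t = x $ i - y $ i"
      define e where "e = min (frac t) (1 - frac t)"
      have e: "e > 0" using i frac_lt_1[of t] by (simp add: e_def t_def)
      have far: "e \<le> \<bar>t + of_int k\<bar>" for k :: int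
      proof (cases "0 \<le> \<lfloor>t\<rfloor> + k")
        case True
        then have "0 \<le> real_of_int (\<lfloor>t\<rfloor> + k)" by simp
        then show ?thesis unfolding e_def frac_def by linarith
      next
        case False
        then have "\<lfloor>t\<rfloor> + k \<le> -1" by simp
        then have "real_of_int (\<lfloor>t\<rfloor> + k) \<le> -1" by linarith
        then show ?thesis unfolding e_def frac_def by linarith
      qed
      have "e \<le> Inf (D p q)"
      proof (rule cInf_greatest[OF D_ne])
        fix s assume "s \<in> D p q"
        then obtain x' y' where s: "s = dist x' y'" "torus_of x' = p" "torus_of y' = q"
          by (auto simp: D_def)
        have "x' $ i - x $ i \<in> \<int>" "y' $ i - y $ i \<in> \<int>"
          using s(2,3) xy by (metis torus_of_eq_iff int_translate_def)+
        then have "(x' $ i - x $ i) - (y' $ i - y $ i) \<in> \<int>" by (rule Ints_diff)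
        then obtain k where k: "(x' $ i - x $ i) - (y' $ i - y $ i) = of_int k"
          by (auto elim: Ints_cases)
        then have "(x' - y') $ i = t + of_int k" by (simp add: t_def)
        then have "e \<le> \<bar>(x' - y') $ i\<bar>" using far[of k] by simp
        also have "\<dots> \<le> s" using component_le_norm_cart[of "x' - y'" i] s(1)
          by (simp add: dist_norm)
        finally show "e \<le> s" .
      qed
      with 0 e show False by (simp add: dist_D)
    qed
  qed
  show "dist p q \<le> dist p r + dist q r"
  proof (rule field_le_epsilon)
    fix e :: real assume "e > 0"
    then have "Inf (D p r) < dist p r + e / 2" "Inf (D q r) < dist q r + e / 2"
      by (simp_all add: dist_D)
    then obtain s s' where s: "s \<in> D p r" "s < dist p r + e / 2"
      and s': "s' \<in> D q r" "s' < dist q r + e / 2"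
      using cInf_lessD[OF D_ne] by metis
    obtain x z where x: "s = dist x z" "torus_of x = p" "torus_of z = r" using s by (auto simp: D_def)
    obtain y w where y: "s' = dist y w" "torus_of y = q" "torus_of w = r" using s' by (auto simp: D_def)
    have "torus_of (y + (z - w)) = q" using torus_of_add_eq[of z w y] x y by simp
    then have "dist x (y + (z - w)) \<in> D p q" using x by (auto simp: D_def)
    then have "dist p q \<le> dist x (y + (z - w))" unfolding dist_D by (rule cInf_lower[OF _ D_bdd])
    also have "\<dots> \<le> dist x z + dist z (y + (z - w))" by (rule dist_triangle)
    also have "dist z (y + (z - w)) = dist y w" by (simp add: dist_norm norm_minus_commute)
    finally show "dist p q \<le> dist p r + dist q r + e" using s s' x y by linarith
  qed
qed

end

lemma dist_torus_of_le: "dist (torus_of x) (torus_of y) \<le> dist x y"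
  unfolding dist_torus_def
proof (rule cInf_lower)
  show "dist x y \<in> {dist x' y' |x' y'. torus_of x' = torus_of x \<and> torus_of y' = torus_of y}"
    by blast
  show "bdd_below {dist x' y' |x' y'. torus_of x' = torus_of x \<and> torus_of y' = torus_of y}"
    by (rule bdd_belowI[of _ 0]) auto
qed

lemma continuous_torus_of: "continuous_on S (torus_of :: real ^ 'n \<Rightarrow> 'n torus)"
  unfolding continuous_on_iff
proof (intro ballI allI impI)
  fix x :: "real ^ 'n" and e :: real
  assume "e > 0"
  then show "\<exists>d>0. \<forall>x'\<in>S. dist x' x < d \<longrightarrow> dist (torus_of x') (torus_of x) < e"
    by (intro exI[of _ e] conjI ballI impI) (auto intro: le_less_trans[OF dist_torus_of_le])
qed

lemma compact_torus: "compact (UNIV :: ('n::finite) torus set)"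
proof -
  have "p \<in> torus_of ` cbox (0 :: real ^ 'n) 1" for p
  proof -
    obtain x where x: "torus_of x = p" using torus_of_surj by blast
    have "int_translate (\<chi> i. frac (x $ i)) x"
      unfolding int_translate_def by (simp add: frac_def)
    then have "p = torus_of (\<chi> i. frac (x $ i))"
      using x torus_of_eq_iff by metis
    moreover have "(\<chi> i. frac (x $ i)) \<in> cbox 0 1"
      by (simp add: mem_box_cart less_imp_le[OF frac_lt_1])
    ultimately show ?thesis by (rule image_eqI)
  qed
  then have "UNIV = torus_of ` cbox (0 :: real ^ 'n) 1" by blast
  then show ?thesis
    using compact_continuous_image[OF continuous_torus_of compact_cbox] by metis
qed

lift_definition toral_map :: "int ^ 'n ^ 'n \<Rightarrow> 'n torus \<Rightarrow> ('n::finite) torus"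
  is "\<lambda>A x. map_matrix real_of_int A *v x"
proof -
  fix A :: "int ^ 'n ^ 'n" and x y :: "real ^ 'n"
  assume "int_translate x y"
  then have xy: "x $ j - y $ j \<in> \<int>" for j by (simp add: int_translate_def)
  have "(\<Sum>j\<in>UNIV. real_of_int (A $ i $ j) * (x $ j - y $ j)) \<in> \<int>" for i
    by (intro Ints_sum Ints_mult Ints_of_int xy)
  moreover have "(map_matrix real_of_int A *v x) $ i - (map_matrix real_of_int A *v y) $ i =
      (\<Sum>j\<in>UNIV. real_of_int (A $ i $ j) * (x $ j - y $ j))" for i
    by (simp only: matrix_vector_mult_def vec_lambda_beta nth_map_matrix
        right_diff_distrib sum_subtractf)
  ultimately show "int_translate (map_matrix real_of_int A *v x) (map_matrix real_of_int A *v y)"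
    by (simp only: int_translate_def simp_thms)
qed

definition charpoly :: "'a::comm_ring_1 ^ 'n ^ 'n \<Rightarrow> 'a poly" where
  "charpoly A = det (mat [:0, 1:] - map_matrix (\<lambda>a. [:a:]) A)"

definition eigenvalue_listing :: "complex ^ 'n ^ 'n \<Rightarrow> ('n \<Rightarrow> complex) \<Rightarrow> bool" where
  "eigenvalue_listing A ev \<longleftrightarrow> charpoly A = (\<Prod>i\<in>UNIV. [:- ev i, 1:])"

definition separated :: "('a::metric_space \<Rightarrow> 'a) \<Rightarrow> nat \<Rightarrow> real \<Rightarrow> 'a set \<Rightarrow> bool" where
  "separated f n \<epsilon> E \<longleftrightarrow>
     (\<forall>x\<in>E. \<forall>y\<in>E. x \<noteq> y \<longrightarrow> (\<exists>j<n. dist ((f ^^ j) x) ((f ^^ j) y) > \<epsilon>))"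

text \<open>The maximum below exists for continuous \<open>f\<close>, compact \<open>K\<close> and \<open>\<epsilon> > 0\<close>;
  see \<open>separated_card_bounded\<close> below.\<close>

definition max_separated :: "('a::metric_space \<Rightarrow> 'a) \<Rightarrow> nat \<Rightarrow> real \<Rightarrow> 'a set \<Rightarrow> nat" where
  "max_separated f n \<epsilon> K = Max {card E |E. E \<subseteq> K \<and> separated f n \<epsilon> E}"

lemma separated_card_bounded:
  fixes f :: "'a::metric_space \<Rightarrow> 'a"
  assumes f: "continuous_on UNIV f" and K: "compact K" and "\<epsilon> > 0"
  shows "\<exists>N. \<forall>E. E \<subseteq> K \<and> separated f n \<epsilon> E \<longrightarrow> finite E \<and> card E \<le> N"
proof -
  define U where "U x = (\<Inter>j<n. {y. dist ((f ^^ j) x) ((f ^^ j) y) < \<epsilon> / 2})" for x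
  have cont: "continuous_on UNIV (f ^^ j)" for j
  proof (induction j)
    case (Suc j)
    have "continuous_on UNIV (f \<circ> (f ^^ j))"
      by (rule continuous_on_compose[OF Suc continuous_on_subset[OF f subset_UNIV]])
    then show ?case by simp
  qed (simp add: id_def)
  have "open (U x)" for x
    unfolding U_def
  proof (intro open_INT finite_lessThan ballI)
    show "open {y. dist ((f ^^ j) x) ((f ^^ j) y) < \<epsilon> / 2}" for j
      by (intro open_Collect_less continuous_on_dist continuous_on_const cont)
  qed
  moreover have "x \<in> U x" for x using \<open>\<epsilon> > 0\<close> by (simp add: U_def)
  ultimately have "K \<subseteq> (\<Union>x\<in>K. U x)" "\<And>x. x \<in> K \<Longrightarrow> open (U x)" by auto
  then obtain C where C: "C \<subseteq> K" "finite C" "K \<subseteq> (\<Union>x\<in>C. U x)"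
    using compactE_image[OF K, of K U] by metis
  have "finite E \<and> card E \<le> card C" if E: "E \<subseteq> K" "separated f n \<epsilon> E" for E
  proof -
    have "\<forall>x\<in>E. \<exists>c\<in>C. x \<in> U c" using E C by blast
    then obtain g where g: "\<And>x. x \<in> E \<Longrightarrow> g x \<in> C \<and> x \<in> U (g x)" by metis
    have "inj_on g E"
    proof (rule inj_onI, rule ccontr)
      fix x y assume xy: "x \<in> E" "y \<in> E" "g x = g y" "x \<noteq> y"
      then obtain j where j: "j < n" "dist ((f ^^ j) x) ((f ^^ j) y) > \<epsilon>"
        using E(2) unfolding separated_def by blast
      have "dist ((f ^^ j) (g x)) ((f ^^ j) x) < \<epsilon> / 2" "dist ((f ^^ j) (g x)) ((f ^^ j) y) < \<epsilon> / 2"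
        using g[OF xy(1)] g[OF xy(2)] xy(3) j(1) by (auto simp: U_def)
      then have "dist ((f ^^ j) x) ((f ^^ j) y) < \<epsilon>" by (metis dist_commute dist_triangle_half_r)
      with j show False by simp
    qed
    moreover have "g ` E \<subseteq> C" using g by blast
    ultimately show ?thesis using C(2) by (metis card_inj_on_le inj_on_finite)
  qed
  then show ?thesis by blast
qed

definition upper_translocal_entropy :: "('a::metric_space \<Rightarrow> 'a) \<Rightarrow> real \<Rightarrow> 'a \<Rightarrow> ereal" where
  "upper_translocal_entropy f \<omega> z =
     Lim (at_right 0) (\<lambda>\<epsilon>. limsup (\<lambda>n.
       ereal (1 / real n * ln (real (max_separated f n \<epsilon> (closure (ball z (exp (- \<omega> * real n)))))))))"

definition lower_translocal_entropy :: "('a::metric_space \<Rightarrow> 'a) \<Rightarrow> real \<Rightarrow> 'a \<Rightarrow> ereal" where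
  "lower_translocal_entropy f \<omega> z =
     Lim (at_right 0) (\<lambda>\<epsilon>. liminf (\<lambda>n.
       ereal (1 / real n * ln (real (max_separated f n \<epsilon> (closure (ball z (exp (- \<omega> * real n)))))))))"

definition has_translocal_entropy :: "('a::metric_space \<Rightarrow> 'a) \<Rightarrow> real \<Rightarrow> 'a \<Rightarrow> ereal \<Rightarrow> bool" where
  "has_translocal_entropy f \<omega> z h \<longleftrightarrow>
     upper_translocal_entropy f \<omega> z = h \<and> lower_translocal_entropy f \<omega> z = h"

end

theory Submission
  imports Defs "Jordan_Normal_Form.Schur_Decomposition"
begin

text \<open>Work in the complexification, where a Schur triangularization \<open>Q ** A = T ** Q\<close> with the
  eigenvalues ordered by increasing modulus gives coordinates \<open>u = Q *v (x + i y)\<close>; pairs of points of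
  a separated set are used as complex points, so that every coordinate contributes twice and all
  counts appear squared. A polydisc with radii proportional to \<open>max 1 (|\<lambda>\<^sub>k| + \<delta>)\<^sup>-\<^sup>n\<close> lies
  in a Bowen ball of order \<open>n\<close>, so subdividing the ball of radius \<open>exp (- \<omega> n)\<close> into such cells
  bounds separated sets from above. Conversely, a grid in the \<open>u\<close>-coordinates with spacings
  proportional to \<open>max 1 |\<lambda>\<^sub>k|\<^sup>1\<^sup>-\<^sup>n\<close> is separated: at the highest coordinate in which two grid points
  differ, the triangular matrix acts by multiplication with \<open>\<lambda>\<^sub>k\<close>. Hence the grid injects into the
  pairs of points of a maximal separated set.\<close>

section \<open>Characteristic polynomials across matrix types and ordered triangularization\<close>

hide_const (open) Determinant.det Matrix.mat Matrix.vec
hide_fact (open) Matrix.vec_eq_iff Matrix.mat_def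
no_notation Matrix.vec_index (infixl \<open>$\<close> 100)

text \<open>Transporting permutations along \<open>b\<close> preserves signs and matches the
  products over rows, so the two Leibniz sums agree term by term. This makes Schur decomposition,
  which works with matrices indexed by \<open>0..<d\<close>, available over a finite index
  type.\<close>

lemma det_mat_of_bij:
  fixes M :: "'a::comm_ring_1 ^ 'n ^ 'n"
  assumes b: "bij_betw b {0..<d} (UNIV :: 'n set)"
  shows "Determinant.det (Matrix.mat d d (\<lambda>(k, l). M $ b k $ b l)) = det M"
proof -
  let ?A = "{0..<d}" and ?\<Phi> = "map_permutation {0..<d} b"
  have inj: "inj_on b ?A" and img: "b ` ?A = UNIV" using b by (auto simp: bij_betw_def)
  define b' where "b' = inv_into ?A b"
  have b': "bij_betw b' UNIV ?A" unfolding b'_def using bij_betw_inv_into[OF b] .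
  have b'b: "b' (b k) = k" if "k \<in> ?A" for k unfolding b'_def using inj that by simp
  have bb': "b (b' i) = i" for i unfolding b'_def using img by (simp add: f_inv_into_f)
  have bij: "bij_betw ?\<Phi> {p. p permutes ?A} {p. p permutes (UNIV :: 'n set)}"
  proof (rule bij_betw_byWitness[where f' = "map_permutation UNIV b'"])
    show "\<forall>p\<in>{p. p permutes ?A}. map_permutation UNIV b' (?\<Phi> p) = p"
      using map_permutation_compose_inv[OF b] b'b by auto
    show "\<forall>p\<in>{p. p permutes (UNIV :: 'n set)}. ?\<Phi> (map_permutation UNIV b' p) = p"
      using map_permutation_compose_inv[OF b'] bb' by auto
  qed (auto intro: map_permutation_permutes[OF b] map_permutation_permutes[OF b'])
  have "det M = (\<Sum>p | p permutes ?A. of_int (sign (?\<Phi> p)) * (\<Prod>i\<in>UNIV. M $ i $ ?\<Phi> p i))"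
    unfolding Determinants.det_def by (rule sum.reindex_bij_betw[OF bij, symmetric])
  also have "\<dots> = (\<Sum>p | p permutes ?A. of_int (sign p) *
      (\<Prod>k = 0..<d. Matrix.mat d d (\<lambda>(k, l). M $ b k $ b l) $$ (k, p k)))"
  proof (intro sum.cong refl arg_cong2[where f = "(*)"])
    fix p assume "p \<in> {p. p permutes ?A}"
    then have p: "p permutes ?A" by simp
    show "of_int (sign (?\<Phi> p)) = (of_int (sign p) :: 'a)"
      using sign_map_permutation[OF inj p] by simp
    have "(\<Prod>i\<in>UNIV. M $ i $ ?\<Phi> p i) = (\<Prod>k\<in>?A. M $ b k $ ?\<Phi> p (b k))"
      by (rule prod.reindex_bij_betw[OF b, symmetric])
    also have "\<dots> = (\<Prod>k = 0..<d. Matrix.mat d d (\<lambda>(k, l). M $ b k $ b l) $$ (k, p k))"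
      using permutes_in_image[OF p] by (intro prod.cong refl) (simp add: map_permutation_apply[OF inj])
    finally show "(\<Prod>i\<in>UNIV. M $ i $ ?\<Phi> p i) =
      (\<Prod>k = 0..<d. Matrix.mat d d (\<lambda>(k, l). M $ b k $ b l) $$ (k, p k))" .
  qed
  finally show ?thesis by (simp add: Determinant.det_def)
qed

lemma char_poly_mat_of_bij:
  fixes M :: "'a::comm_ring_1 ^ 'n ^ 'n"
  assumes b: "bij_betw b {0..<d} (UNIV :: 'n set)"
  shows "char_poly (Matrix.mat d d (\<lambda>(k, l). M $ b k $ b l)) = charpoly M"
proof -
  have "char_poly_matrix (Matrix.mat d d (\<lambda>(k, l). M $ b k $ b l)) =
    Matrix.mat d d (\<lambda>(k, l). (mat [:0, 1:] - map_matrix (\<lambda>a. [:a:]) M) $ b k $ b l)"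
    using b by (intro eq_matI)
      (auto simp: char_poly_matrix_def mat_def bij_betw_def inj_on_def)
  then show ?thesis
    unfolding char_poly_def charpoly_def by (simp only: det_mat_of_bij[OF b])
qed

text \<open>Schur decomposition realizes any prescribed order of the eigenvalues on the diagonal.
  Here they are listed by increasing modulus, and \<open>r i\<close> is the position of the index
  \<open>i\<close> in that list; triangularity is expressed through these positions.\<close>

lemma sorted_triangularization:
  fixes M :: "complex ^ 'n ^ 'n"
  assumes ev: "eigenvalue_listing M ev"
  obtains P Q T :: "complex ^ 'n ^ 'n" and r :: "'n \<Rightarrow> nat"
  where "inj r" "P ** Q = mat 1" "Q ** P = mat 1" "Q ** M = T ** Q"
    and "\<And>i j. r j < r i \<Longrightarrow> T $ i $ j = 0" "\<And>i. T $ i $ i = ev i"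
    and "\<And>i j. r i \<le> r j \<Longrightarrow> cmod (ev i) \<le> cmod (ev j)"
proof -
  obtain xs where xs: "set xs = (UNIV :: 'n set)" "distinct xs"
    using finite_distinct_list[of "UNIV :: 'n set"] by auto
  define ys where "ys = sort_key (\<lambda>i. cmod (ev i)) xs"
  have ys: "set ys = UNIV" "distinct ys" "sorted (map (\<lambda>i. cmod (ev i)) ys)"
    using xs by (auto simp: ys_def)
  define d where "d = length ys"
  define b where "b k = ys ! k" for k
  have b: "bij_betw b {0..<d} (UNIV :: 'n set)"
    unfolding b_def d_def using bij_betw_nth[OF ys(2) _ ys(1)[symmetric]] 
    by (simp add: atLeast0LessThan)
  define r where "r = inv_into {0..<d} b"
  have r: "bij_betw r UNIV {0..<d}" unfolding r_def by (rule bij_betw_inv_into[OF b])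
  have br: "b (r i) = i" for i using b by (simp add: r_def bij_betw_def f_inv_into_f)
  have rb: "r (b k) = k" if "k < d" for k using b that by (simp add: r_def bij_betw_def)
  have rd: "r i < d" for i using r by (auto simp: bij_betw_def)
  define A where "A = Matrix.mat d d (\<lambda>(k, l). M $ b k $ b l)"
  have A: "A \<in> carrier_mat d d" by (simp add: A_def)
  have "char_poly A = (\<Prod>i\<in>UNIV. [:- ev i, 1:])"
    using ev by (simp add: A_def char_poly_mat_of_bij[OF b] eigenvalue_listing_def)
  also have "\<dots> = (\<Prod>e\<leftarrow>map ev ys. [:- e, 1:])"
    using prod.distinct_set_conv_list[OF ys(2), of "\<lambda>i. [:- ev i, 1:]"] ys(1) by (simp add: o_def)
  finally have cp: "char_poly A = (\<Prod>e\<leftarrow>map ev ys. [:- e, 1:])" .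
  obtain B P Q where "schur_decomposition A (map ev ys) = (B, P, Q)" by (metis prod_cases3)
  from schur_decomposition[OF A cp this]
  have wit: "similar_mat_wit A B P Q" and up: "upper_triangular B" and diag: "diag_mat B = map ev ys"
    by auto
  note w = similar_mat_witD2[OF A wit]
  have carr: "B \<in> carrier_mat d d" "P \<in> carrier_mat d d" "Q \<in> carrier_mat d d" using w by auto
  have QA: "Q * A = B * Q"
  proof -
    have "Q * A = Q * (P * (B * Q))" using w(3) assoc_mult_mat[OF carr(2,1,3)] by simp
    also have "\<dots> = (Q * P) * (B * Q)"
      by (rule assoc_mult_mat[OF carr(3,2), symmetric]) (use carr in auto)
    also have "\<dots> = B * Q" using w(2) carr by simp
    finally show ?thesis .
  qed
  \<comment> \<open>Entries are pulled back along \<open>r\<close>; since \<open>r\<close> is a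
    bijection onto \<open>0..<d\<close>, \<open>F\<close> respects products and the
    identity.\<close>
  define F :: "complex Matrix.mat \<Rightarrow> complex ^ 'n ^ 'n" where "F X = (\<chi> i j. X $$ (r i, r j))" for X
  have F_mult: "F (X * Y) = F X ** F Y" if "X \<in> carrier_mat d d" "Y \<in> carrier_mat d d" for X Y
  proof -
    have "(X * Y) $$ (r i, r j) = (\<Sum>k\<in>UNIV. X $$ (r i, r k) * Y $$ (r k, r j))" for i j
    proof -
      have "(X * Y) $$ (r i, r j) = (\<Sum>k\<in>{0..<d}. X $$ (r i, k) * Y $$ (k, r j))"
        using that rd[of i] rd[of j] by (simp add: scalar_prod_def)
      then show ?thesis by (simp add: sum.reindex_bij_betw[OF r, of "\<lambda>k. X $$ (r i, k) * Y $$ (k, r j)"])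
    qed
    then show ?thesis by (simp add: F_def matrix_matrix_mult_def)
  qed
  have r_inj: "inj r" using r by (simp add: bij_betw_def)
  have F_one: "F (1\<^sub>m d) = mat 1"
    using rd r_inj by (auto simp: F_def mat_def vec_eq_iff inj_eq)
  have F_A: "F A = M" using rd by (simp add: F_def A_def br vec_eq_iff)
  have ev_diag: "B $$ (r i, r i) = ev i" for i
  proof -
    have "map ev ys ! r i = B $$ (r i, r i)"
      unfolding diag[symmetric] diag_mat_def using rd[of i] carr(1) by simp
    moreover have "map ev ys ! r i = ev (b (r i))" using rd[of i] by (simp add: b_def d_def)
    ultimately show ?thesis by (simp add: br)
  qed
  show thesis
  proof (rule that)
    show "inj r" by (rule r_inj)
    show "F P ** F Q = mat 1" "F Q ** F P = mat 1" "F Q ** M = F B ** F Q"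
      using F_mult[OF carr(2,3)] F_mult[OF carr(3,2)] F_mult[OF carr(3) A] F_mult[OF carr(1,3)]
        w(1,2) QA by (simp_all add: F_one F_A)
    show "F B $ i $ j = 0" if "r j < r i" for i j
      using upper_triangularD[OF up that] rd[of i] carr(1) by (simp add: F_def)
    show "F B $ i $ i = ev i" for i by (simp add: F_def ev_diag)
    show "cmod (ev i) \<le> cmod (ev j)" if "r i \<le> r j" for i j
    proof -
      have "map (\<lambda>i. cmod (ev i)) ys ! r i \<le> map (\<lambda>i. cmod (ev i)) ys ! r j"
        using sorted_nth_mono[OF ys(3) that] rd[of j] by (simp add: d_def)
      then have "cmod (ev (b (r i))) \<le> cmod (ev (b (r j)))"
        using rd[of i] rd[of j] by (simp add: b_def d_def)
      then show ?thesis by (simp add: br)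
    qed
  qed
qed

section \<open>Torus distances and toral iterates through lifts\<close>

text \<open>Lifts of the two points differ by \<open>w + k\<close> for an integer vector
  \<open>k\<close>. If \<open>k\<close> is nonzero, some coordinate of \<open>w + k\<close> has
  absolute value at least 1/2, so the infimum is attained at \<open>k = 0\<close>.\<close>

lemma dist_torus_of_add:
  fixes p w :: "real ^ 'n"
  assumes w: "norm w < 1 / 2"
  shows "dist (torus_of (p + w)) (torus_of p) = norm w"
proof (rule antisym)
  show "dist (torus_of (p + w)) (torus_of p) \<le> norm w"
    using dist_torus_of_le[of "p + w" p] by (simp add: dist_norm)
  show "norm w \<le> dist (torus_of (p + w)) (torus_of p)"
    unfolding dist_torus_def
  proof (rule cInf_greatest)
    show "{dist x y |x y. torus_of x = torus_of (p + w) \<and> torus_of y = torus_of p} \<noteq> {}" by blast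
    fix s assume "s \<in> {dist x y |x y. torus_of x = torus_of (p + w) \<and> torus_of y = torus_of p}"
    then obtain x y where s: "s = dist x y" and xy: "torus_of x = torus_of (p + w)" "torus_of y = torus_of p"
      by blast
    define k where "k = (x - (p + w)) - (y - p)"
    have k: "k $ i \<in> \<int>" for i
    proof -
      have "x $ i - (p + w) $ i \<in> \<int>" "y $ i - p $ i \<in> \<int>"
        using xy by (metis torus_of_eq_iff int_translate_def)+
      then have "(x $ i - (p + w) $ i) - (y $ i - p $ i) \<in> \<int>" by (rule Ints_diff)
      then show ?thesis by (simp only: k_def vector_minus_component)
    qed
    have diff: "x - y = w + k" by (simp add: k_def)
    show "norm w \<le> s"
    proof (cases "k = 0")
      case True
      then show ?thesis using diff by (simp add: s dist_norm)
    next
      case False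
      then obtain i where i: "k $ i \<noteq> 0" by (auto simp: vec_eq_iff)
      then have "1 \<le> \<bar>k $ i\<bar>" using k[of i] by (metis Ints_nonzero_abs_ge1)
      moreover have "\<bar>w $ i\<bar> < 1 / 2" using component_le_norm_cart[of w i] w by linarith
      ultimately have "1 / 2 \<le> \<bar>(w + k) $ i\<bar>" unfolding vector_add_component by linarith
      also have "\<dots> \<le> s" using component_le_norm_cart[of "w + k" i] by (simp add: s dist_norm diff)
      finally show ?thesis using w by simp
    qed
  qed
qed

text \<open>As the inequality is strict, some pair of lifts has distance below \<open>s\<close>; an
  integer translation of that pair moves the second lift to the prescribed \<open>p\<close>.\<close>

lemma near_torus_of:
  fixes p :: "real ^ 'n"
  assumes "dist q (torus_of p) < s"
  obtains v where "norm v < s" "q = torus_of (p + v)"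
proof -
  have "{dist x y |x y. torus_of x = q \<and> torus_of y = torus_of p} \<noteq> {}"
    using torus_of_surj[of q] by blast
  then obtain x y where xy: "dist x y < s" "torus_of x = q" "torus_of y = torus_of p"
    using cInf_lessD[of "{dist x y |x y. torus_of x = q \<and> torus_of y = torus_of p}" s] assms
    by (auto simp: dist_torus_def)
  have "q = torus_of (p + (x - y))" using torus_of_add_eq[of p y x] xy by (simp add: algebra_simps)
  with xy(1) show thesis by (intro that[of "x - y"]) (auto simp: dist_norm)
qed

lemma linear_iterate:
  fixes L :: "'a::real_vector \<Rightarrow> 'a"
  assumes "linear L"
  shows "linear (L ^^ j)"
proof (induction j)
  case (Suc j)
  then show ?case using linear_compose[OF Suc assms] by (simp add: o_def)
qed (simp add: id_def linear_ident)

lemma toral_map_iterate: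
  "(toral_map A ^^ j) (torus_of x) = torus_of (((*v) (map_matrix real_of_int A) ^^ j) x)"
  by (induction j) (simp_all add: toral_map.abs_eq)

lemma continuous_toral_map: "continuous_on UNIV (toral_map A)"
proof -
  have "linear ((*v) (map_matrix real_of_int A))" by (rule matrix_vector_mul_linear)
  then obtain a where a: "a > 0" "\<And>v. norm (map_matrix real_of_int A *v v) \<le> a * norm v"
    using linear_bounded_pos by blast
  show ?thesis
    unfolding continuous_on_iff
  proof (intro ballI allI impI)
    fix p :: "'a torus" and e :: real assume "e > 0"
    show "\<exists>d>0. \<forall>q\<in>UNIV. dist q p < d \<longrightarrow> dist (toral_map A q) (toral_map A p) < e"
    proof (intro exI[of _ "e / a"] conjI ballI impI)
      show "e / a > 0" using \<open>e > 0\<close> a by simp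
      fix q assume q: "dist q p < e / a"
      obtain x where x: "p = torus_of x" using torus_of_surj by metis
      obtain v where v: "norm v < e / a" "q = torus_of (x + v)"
        using near_torus_of q unfolding x by blast
      have "dist (toral_map A q) (toral_map A p) \<le> norm (map_matrix real_of_int A *v v)"
        using dist_torus_of_le[of "map_matrix real_of_int A *v (x + v)" "map_matrix real_of_int A *v x"]
        by (simp add: x v(2) toral_map.abs_eq dist_norm matrix_vector_right_distrib)
      also have "\<dots> \<le> a * norm v" by (rule a)
      also have "\<dots> < e" using v(1) a(1) by (simp add: field_simps)
      finally show "dist (toral_map A q) (toral_map A p) < e" .
    qed
  qed
qed

text \<open>Below the scale 1/2 the distance on the torus is the norm of the difference of lifts, and the
  bound on \<open>a * e\<close> keeps the next iterate of the difference below that scale.\<close>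

lemma iterates_norm_le:
  fixes A :: "int ^ 'n ^ 'n" and p v :: "real ^ 'n"
  defines "L \<equiv> (*v) (map_matrix real_of_int A)"
  assumes a: "\<And>v. norm (L v) \<le> a * norm v" "a \<ge> 0" "a * e < 1 / 2"
    and v: "norm v < 1 / 2"
    and close: "\<And>j. j < n \<Longrightarrow>
      dist ((toral_map A ^^ j) (torus_of (p + v))) ((toral_map A ^^ j) (torus_of p)) \<le> e"
    and "j < n"
  shows "norm ((L ^^ j) v) \<le> e"
proof -
  have lin: "linear (L ^^ j)" for j unfolding L_def by (intro linear_iterate matrix_vector_mul_linear)
  have le: "norm ((L ^^ j) v) \<le> e" if "j < n" "norm ((L ^^ j) v) < 1 / 2" for j
    using close[OF that(1)] dist_torus_of_add[OF that(2), of "(L ^^ j) p"]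
    by (simp add: toral_map_iterate L_def[symmetric] linear_add[OF lin])
  show ?thesis using \<open>j < n\<close>
  proof (induction j)
    case 0
    then show ?case using le[of 0] v by simp
  next
    case (Suc j)
    have "norm ((L ^^ Suc j) v) \<le> a * norm ((L ^^ j) v)" using a(1) by simp
    also have "\<dots> \<le> a * e" using Suc a(2) by (intro mult_left_mono) auto
    finally show ?case using le[of "Suc j"] Suc.prems a(3) by linarith
  qed
qed

section \<open>Maximal separated sets\<close>

text \<open>A separated set of maximal cardinality is also spanning, because a point of
  \<open>K\<close> that no element shadows could be added to it. The upper count uses the
  separation, the lower count the spanning property.\<close>

lemma max_separated_attained:
  fixes f :: "'a::metric_space \<Rightarrow> 'a"
  assumes "continuous_on UNIV f" "compact K" "\<epsilon> > 0"
  obtains E where "E \<subseteq> K" "finite E" "separated f n \<epsilon> E" "card E = max_separated f n \<epsilon> K"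
    and "\<And>x. x \<in> K \<Longrightarrow> \<exists>e\<in>E. \<forall>j<n. dist ((f ^^ j) x) ((f ^^ j) e) \<le> \<epsilon>"
proof -
  obtain N where N: "\<And>E. E \<subseteq> K \<Longrightarrow> separated f n \<epsilon> E \<Longrightarrow> finite E \<and> card E \<le> N"
    using separated_card_bounded[OF assms] by metis
  let ?S = "{card E |E. E \<subseteq> K \<and> separated f n \<epsilon> E}"
  \<comment> \<open>\<open>Max\<close> is a genuine maximum: the cardinalities are bounded by
    \<open>N\<close> and include that of the empty set.\<close>
  have fin: "finite ?S" by (rule finite_subset[of _ "{..N}"]) (use N in auto)
  have "card ({} :: 'a set) \<in> ?S" by (force simp: separated_def)
  then have "max_separated f n \<epsilon> K \<in> ?S" unfolding max_separated_def using fin by (intro Max_in) auto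
  then obtain E where E: "E \<subseteq> K" "separated f n \<epsilon> E" "card E = max_separated f n \<epsilon> K" by auto
  have finE: "finite E" using N E by blast
  show thesis
  proof (rule that[OF E(1) finE E(2,3)])
    fix x assume x: "x \<in> K"
    show "\<exists>e\<in>E. \<forall>j<n. dist ((f ^^ j) x) ((f ^^ j) e) \<le> \<epsilon>"
    proof (rule ccontr)
      assume "\<not> ?thesis"
      then have far: "\<exists>j<n. dist ((f ^^ j) x) ((f ^^ j) e) > \<epsilon>" if "e \<in> E" for e
        using that by (meson not_le)
      then have "x \<notin> E" using \<open>\<epsilon> > 0\<close> by fastforce
      have "separated f n \<epsilon> (insert x E)"
        using E(2) far unfolding separated_def by (metis dist_commute insert_iff)
      then have "card (insert x E) \<in> ?S" using x E(1) by blast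
      then have "card (insert x E) \<le> card E"
        unfolding E(3) max_separated_def using fin by (intro Max_ge) auto
      with \<open>x \<notin> E\<close> finE show False by simp
    qed
  qed
qed

section \<open>Growth of iterates of triangular matrices\<close>

text \<open>Complex vectors are viewed as a real normed space, so that operator bounds for real
  linear maps apply to \<open>P\<close> and \<open>Q\<close>.\<close>

lemma linear_complex_matrix: "linear ((*v) (B :: complex ^ 'n ^ 'm))"
proof (rule linearI)
  show "B *v (x + y) = B *v x + B *v y" for x y by (rule matrix_vector_right_distrib)
  show "B *v (c *\<^sub>R x) = c *\<^sub>R (B *v x)" for c x
    by (simp add: matrix_vector_mult_def vec_eq_iff scaleR_sum_right)
qed

text \<open>The \<open>i\<close>-th coordinate of \<open>T *v u\<close> involves only coordinates with eigenvalues of at least the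
  same modulus, and the weights \<open>K ^ r i\<close> make the off-diagonal contribution at most \<open>\<delta>\<close>.\<close>

lemma triangular_growth:
  fixes T :: "complex ^ 'n ^ 'n" and r :: "'n \<Rightarrow> nat" and \<delta> :: real
  assumes T: "\<And>i j. r j < r i \<Longrightarrow> T $ i $ j = 0" "\<And>i. T $ i $ i = ev i" and r: "inj r"
    and mono: "\<And>i j. r i \<le> r j \<Longrightarrow> cmod (ev i) \<le> cmod (ev j)" and "\<delta> > 0"
  obtains C where "C > 0"
    and "\<forall>j u i. cmod (((*v) T ^^ j) u $ i) \<le> C * (\<Sum>k\<in>UNIV. (cmod (ev k) + \<delta>) ^ j * cmod (u $ k))"
proof -
  define \<mu> where "\<mu> k = cmod (ev k) + \<delta>" for k
  define S where "S = (\<Sum>i\<in>UNIV. \<Sum>l\<in>UNIV. cmod (T $ i $ l))"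
  \<comment> \<open>Chosen so that \<open>S / K \<le> \<delta>\<close>.\<close>
  define K where "K = 1 + S / \<delta>"
  define w where "w k = K ^ r k" for k
  have "S \<ge> 0" by (simp add: S_def sum_nonneg)
  then have K: "K \<ge> 1" using \<open>\<delta> > 0\<close> by (simp add: K_def)
  have \<mu>: "\<mu> k \<ge> 0" for k using \<open>\<delta> > 0\<close> by (simp add: \<mu>_def)
  have w: "w k \<ge> 1" for k using K by (simp add: w_def)
  \<comment> \<open>The bound to be proved for the weighted coordinate \<open>i\<close>. It
    decreases as the position grows, and a factor \<open>\<mu> i\<close> is absorbed by passing from
    \<open>j\<close> to \<open>Suc j\<close>.\<close>
  define g where "g j u i = (\<Sum>k | r i \<le> r k. \<mu> k ^ j * (w k * cmod (u $ k)))" for j u i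
  have g0: "g j u i \<ge> 0" for j u i
    unfolding g_def using \<mu> w by (intro sum_nonneg mult_nonneg_nonneg zero_le_power) (auto intro: order_trans[OF zero_le_one])
  have g_mono: "g j u l \<le> g j u i" if "r i \<le> r l" for j u i l
    unfolding g_def using \<mu> w that
    by (intro sum_mono2 mult_nonneg_nonneg zero_le_power) (auto intro: order_trans[OF zero_le_one])
  have g_Suc: "\<mu> i * g j u i \<le> g (Suc j) u i" for j u i
  proof -
    have "\<mu> i * g j u i = (\<Sum>k | r i \<le> r k. \<mu> i * (\<mu> k ^ j * (w k * cmod (u $ k))))"
      by (simp add: g_def sum_distrib_left)
    \<comment> \<open>The ordering of the moduli enters here: \<open>\<mu> i \<le> \<mu> k\<close>
      on the index set of the sum.\<close>
    also have "\<dots> \<le> (\<Sum>k | r i \<le> r k. \<mu> k * (\<mu> k ^ j * (w k * cmod (u $ k))))"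
      using mono \<mu> w by (intro sum_mono mult_right_mono mult_nonneg_nonneg zero_le_power)
        (auto simp: \<mu>_def intro: order_trans[OF zero_le_one])
    also have "\<dots> = g (Suc j) u i" by (simp add: g_def mult.assoc)
    finally show ?thesis .
  qed
  have main: "w i * cmod (((*v) T ^^ j) u $ i) \<le> g j u i" for j u i
  proof (induction j arbitrary: i)
    case 0
    show ?case unfolding g_def using w
      by (intro order_trans[OF _ member_le_sum[of i]])
        (auto intro!: mult_nonneg_nonneg intro: order_trans[OF zero_le_one])
  next
    case (Suc j)
    define x where "x = ((*v) T ^^ j) u"
    have term_le: "w i * (cmod (T $ i $ l) * cmod (x $ l)) \<le> (if l = i then cmod (ev i) else cmod (T $ i $ l) / K) * g j u i" for l
    proof -
      consider "l = i" | "r l < r i" | "r i < r l" using r by (metis injD linorder_neqE_nat)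
      then show ?thesis
      proof cases
        case 1
        then show ?thesis using mult_left_mono[OF Suc.IH[of i], of "cmod (ev i)"] T(2)
          by (simp add: x_def mult_ac)
      next
        case 2
        then show ?thesis using T(1) by auto
      next
        case 3
        \<comment> \<open>A strictly higher position carries at least one more factor
          \<open>K\<close>, which pays for the division by \<open>K\<close>.\<close>
        then have "K ^ Suc (r i) \<le> w l" unfolding w_def using K by (intro power_increasing) auto
        then have "w i \<le> w l / K" using K by (simp add: w_def field_simps)
        then have "w i * (cmod (T $ i $ l) * cmod (x $ l)) \<le> (w l / K) * (cmod (T $ i $ l) * cmod (x $ l))"
          by (intro mult_right_mono) auto
        also have "\<dots> = cmod (T $ i $ l) / K * (w l * cmod (x $ l))" by simp
        also have "\<dots> \<le> cmod (T $ i $ l) / K * g j u i"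
          using order_trans[OF Suc.IH g_mono] 3 K by (intro mult_left_mono) (auto simp: x_def)
        finally show ?thesis using 3 by auto
      qed
    qed
    have "w i * cmod (((*v) T ^^ Suc j) u $ i) = w i * cmod (\<Sum>l\<in>UNIV. T $ i $ l * x $ l)"
      by (simp add: x_def matrix_vector_mult_def)
    also have "\<dots> \<le> w i * (\<Sum>l\<in>UNIV. cmod (T $ i $ l) * cmod (x $ l))"
      using w[of i] norm_sum[of "\<lambda>l. T $ i $ l * x $ l" UNIV] by (intro mult_left_mono) (auto simp: norm_mult)
    also have "\<dots> \<le> (\<Sum>l\<in>UNIV. (if l = i then cmod (ev i) else cmod (T $ i $ l) / K) * g j u i)"
      unfolding sum_distrib_left by (intro sum_mono term_le)
    also have "\<dots> = (\<Sum>l\<in>UNIV. if l = i then cmod (ev i) else cmod (T $ i $ l) / K) * g j u i"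
      by (simp add: sum_distrib_right)
    also have "\<dots> \<le> \<mu> i * g j u i"
    proof (intro mult_right_mono g0)
      have "(\<Sum>l\<in>UNIV. if l = i then cmod (ev i) else cmod (T $ i $ l) / K)
          \<le> (\<Sum>l\<in>UNIV. (if l = i then cmod (ev i) else 0) + cmod (T $ i $ l) / K)"
        using K by (intro sum_mono) auto
      also have "\<dots> = cmod (ev i) + (\<Sum>l\<in>UNIV. cmod (T $ i $ l)) / K"
        by (simp add: sum.distrib sum_divide_distrib)
      also have "(\<Sum>l\<in>UNIV. cmod (T $ i $ l)) \<le> S"
        unfolding S_def by (rule member_le_sum[of i UNIV "\<lambda>i. \<Sum>l\<in>UNIV. cmod (T $ i $ l)"]) (auto intro: sum_nonneg)
      also have "S / K \<le> \<delta>"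
        using K \<open>\<delta> > 0\<close> \<open>S \<ge> 0\<close> by (simp add: K_def field_simps)
      finally show "(\<Sum>l\<in>UNIV. if l = i then cmod (ev i) else cmod (T $ i $ l) / K) \<le> \<mu> i"
        using K by (simp add: \<mu>_def divide_right_mono)
    qed
    also have "\<dots> \<le> g (Suc j) u i" by (rule g_Suc)
    finally show ?case .
  qed
  define C where "C = (\<Sum>k\<in>UNIV. w k)"
  have wC: "w k \<le> C" for k
    unfolding C_def using w by (intro member_le_sum) (auto intro: order_trans[OF zero_le_one])
  show thesis
  proof (rule that)
    show "C > 0" using wC[of undefined] w[of undefined] by linarith
  next
    show "\<forall>j u i. cmod (((*v) T ^^ j) u $ i) \<le> C * (\<Sum>k\<in>UNIV. (cmod (ev k) + \<delta>) ^ j * cmod (u $ k))"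
    proof (intro allI)
      fix j i and u :: "complex ^ 'n"
      have "cmod (((*v) T ^^ j) u $ i) \<le> w i * cmod (((*v) T ^^ j) u $ i)"
        using mult_right_mono[OF w[of i]] by simp
      also have "\<dots> \<le> g j u i" by (rule main)
      also have "\<dots> \<le> (\<Sum>k | r i \<le> r k. \<mu> k ^ j * (C * cmod (u $ k)))"
        unfolding g_def using \<mu> wC by (intro sum_mono mult_left_mono mult_right_mono) auto
      also have "\<dots> \<le> (\<Sum>k\<in>UNIV. \<mu> k ^ j * (C * cmod (u $ k)))"
        using \<mu> order_trans[OF order_trans[OF zero_le_one w] wC] by (intro sum_mono2) auto
      also have "\<dots> = C * (\<Sum>k\<in>UNIV. \<mu> k ^ j * cmod (u $ k))" by (simp add: sum_distrib_left mult_ac)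
      finally show "cmod (((*v) T ^^ j) u $ i) \<le> C * (\<Sum>k\<in>UNIV. (cmod (ev k) + \<delta>) ^ j * cmod (u $ k))"
        by (simp add: \<mu>_def)
    qed
  qed
qed

section \<open>Complexified displacements and triangular coordinates\<close>

text \<open>Pairs of real displacements exhaust the complex vector space, so boxes and grids in
  triangular coordinates can be counted in full dimension, without a real canonical form.\<close>

definition complexify :: "real ^ 'n \<Rightarrow> real ^ 'n \<Rightarrow> complex ^ 'n" where
  "complexify x y = (\<chi> i. Complex (x $ i) (y $ i))"

lemma complexify_Re_Im: "complexify (\<chi> i. Re (v $ i)) (\<chi> i. Im (v $ i)) = v"
  by (simp add: complexify_def vec_eq_iff)

lemma complexify_diff: "complexify x y - complexify x' y' = complexify (x - x') (y - y')"
  by (simp add: complexify_def vec_eq_iff complex_eq_iff)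

lemma norm_complexify:
  "norm x \<le> norm (complexify x y)" "norm y \<le> norm (complexify x y)"
  "norm (complexify x y) \<le> norm x + norm y"
proof -
  show "norm x \<le> norm (complexify x y)" "norm y \<le> norm (complexify x y)"
    unfolding norm_vec_def complexify_def
    using abs_Re_le_cmod[of "Complex (x $ i) (y $ i)" for i] abs_Im_le_cmod[of "Complex (x $ i) (y $ i)" for i]
    by (auto intro!: L2_set_mono)
  have "norm (complexify x y) \<le> L2_set (\<lambda>i. norm (x $ i) + norm (y $ i)) UNIV"
    unfolding norm_vec_def complexify_def
    using cmod_le[of "Complex (x $ i) (y $ i)" for i] by (auto intro!: L2_set_mono)
  also have "\<dots> \<le> norm x + norm y" unfolding norm_vec_def by (rule L2_set_triangle_ineq)
  finally show "norm (complexify x y) \<le> norm x + norm y" .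
qed

text \<open>The matrix has real entries, so it acts on real and imaginary parts separately.\<close>

lemma complexify_iterate:
  fixes A :: "int ^ 'n ^ 'n"
  shows "((*v) (map_matrix of_int A) ^^ j) (complexify x y) =
    complexify (((*v) (map_matrix real_of_int A) ^^ j) x) (((*v) (map_matrix real_of_int A) ^^ j) y)"
proof (induction j)
  case (Suc j)
  have "map_matrix of_int A *v complexify a b =
      complexify (map_matrix real_of_int A *v a) (map_matrix real_of_int A *v b)" for a b
    by (simp add: complexify_def matrix_vector_mult_def vec_eq_iff complex_eq_iff)
  with Suc show ?case by simp
qed simp

lemma iterate_intertwine:
  assumes "\<And>v. g (f v) = h (g v)"
  shows "g ((f ^^ j) v) = (h ^^ j) (g v)"
  by (induction j) (simp_all add: assms)

lemma matrix_iterate_intertwine: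
  fixes Q M T :: "'a::comm_ring_1 ^ 'n ^ 'n"
  assumes "Q ** M = T ** Q"
  shows "Q *v ((*v) M ^^ j) v = ((*v) T ^^ j) (Q *v v)"
  by (rule iterate_intertwine) (simp add: matrix_vector_mul_assoc assms)

text \<open>Triangularity preserves the vanishing above position \<open>r k\<close>, so row
  \<open>k\<close> sees only its diagonal entry. This gives the lower count an exact growth rate,
  without the loss \<delta>.\<close>

lemma triangular_iterate_top:
  fixes T :: "complex ^ 'n ^ 'n" and r :: "'n \<Rightarrow> nat"
  assumes T: "\<And>i j. r j < r i \<Longrightarrow> T $ i $ j = 0" and r: "inj r"
    and u: "\<And>l. r k < r l \<Longrightarrow> u $ l = 0"
  shows "((*v) T ^^ j) u $ k = (T $ k $ k) ^ j * u $ k"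
proof -
  have "((*v) T ^^ j) u $ k = (T $ k $ k) ^ j * u $ k \<and> (\<forall>l. r k < r l \<longrightarrow> ((*v) T ^^ j) u $ l = 0)"
  proof (induction j)
    case 0
    then show ?case using u by simp
  next
    case (Suc j)
    define x where "x = ((*v) T ^^ j) u"
    have x: "x $ k = (T $ k $ k) ^ j * u $ k" "\<And>l. r k < r l \<Longrightarrow> x $ l = 0"
      using Suc by (auto simp: x_def)
    have "(T *v x) $ k = (\<Sum>l\<in>UNIV. if l = k then T $ k $ k * x $ k else 0)"
      unfolding matrix_vector_mult_def vec_lambda_beta
    proof (intro sum.cong refl)
      show "T $ k $ l * x $ l = (if l = k then T $ k $ k * x $ k else 0)" for l
        using T[of l k] x(2)[of l] r by (metis injD linorder_neqE_nat mult_zero_left mult_zero_right)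
    qed
    moreover have "(T *v x) $ l = 0" if l: "r k < r l" for l
      unfolding matrix_vector_mult_def vec_lambda_beta
    proof (intro sum.neutral ballI)
      show "T $ l $ m * x $ m = 0" for m
        using T[of m l] x(2)[of m] l by (cases "r m < r l") auto
    qed
    ultimately show ?case using x(1) by (simp add: x_def)
  qed
  then show ?thesis by simp
qed

section \<open>Counting through injections of pairs\<close>

lemma norm_cvec_le: "norm (v :: complex ^ 'n) \<le> (\<Sum>i\<in>UNIV. cmod (v $ i))"
  unfolding norm_vec_def by (intro L2_set_le_sum) simp

lemma norm_cvec_le_bound:
  fixes v :: "complex ^ 'n"
  assumes "\<And>i. cmod (v $ i) \<le> s"
  shows "norm v \<le> real CARD('n) * s"
  using norm_cvec_le[of v] sum_mono[of UNIV "\<lambda>i. cmod (v $ i)" "\<lambda>_. s"] assms by simp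

text \<open>Each \<open>X k\<close> serves both the real and the imaginary part of a coordinate, so
  both sides of the counting inequality are squares and roots can be taken.\<close>

lemma card_square_le_prod:
  fixes \<phi> :: "'e \<Rightarrow> 'e \<Rightarrow> 'n::finite \<Rightarrow> 'c \<times> 'c"
  assumes fin: "finite E" "\<And>k. finite (X k)"
    and inj: "inj_on (\<lambda>(e, e'). \<phi> e e') (E \<times> E)"
    and mem: "\<And>e e' k. e \<in> E \<Longrightarrow> e' \<in> E \<Longrightarrow> \<phi> e e' k \<in> X k \<times> X k"
  shows "card E \<le> (\<Prod>k\<in>UNIV. card (X k))"
proof -
  have "card (E \<times> E) \<le> card (PiE UNIV (\<lambda>k. X k \<times> X k))"
    using inj mem fin by (intro card_inj_on_le[of "\<lambda>(e, e'). \<phi> e e'"]) (auto intro!: finite_PiE)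
  also have "\<dots> = (\<Prod>k\<in>UNIV. card (X k))\<^sup>2"
    by (simp add: card_PiE card_cartesian_product prod.distrib power2_eq_square)
  finally show ?thesis by (simp add: card_cartesian_product power2_nat_le_eq_le flip: power2_eq_square)
qed

text \<open>The same comparison of squares with the injection reversed, from grid points into pairs
  of points.\<close>

lemma prod_le_card_square:
  fixes \<psi> :: "('n::finite \<Rightarrow> 'c \<times> 'c) \<Rightarrow> 'e \<times> 'e"
  assumes fin: "finite E"
    and inj: "inj_on \<psi> (PiE UNIV (\<lambda>k. X k \<times> X k))"
    and mem: "\<And>h. h \<in> PiE UNIV (\<lambda>k. X k \<times> X k) \<Longrightarrow> \<psi> h \<in> E \<times> E"
  shows "(\<Prod>k\<in>UNIV. card (X k)) \<le> card E"
proof -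
  have "(\<Prod>k\<in>UNIV. card (X k))\<^sup>2 = card (PiE UNIV (\<lambda>k. X k \<times> X k))"
    by (simp add: card_PiE card_cartesian_product prod.distrib power2_eq_square)
  also have "\<dots> \<le> card (E \<times> E)"
    using inj mem fin by (intro card_inj_on_le[of \<psi>] image_subsetI) auto
  finally show ?thesis by (simp add: card_cartesian_product power2_nat_le_eq_le flip: power2_eq_square)
qed

lemma floor_divide_eq_imp_close:
  fixes x y s :: real
  assumes "\<lfloor>x / s\<rfloor> = \<lfloor>y / s\<rfloor>" "s > 0"
  shows "\<bar>x - y\<bar> < s"
proof -
  have "\<bar>x / s - y / s\<bar> < 1" using assms(1) by linarith
  then show ?thesis using assms(2) by (simp add: flip: diff_divide_distrib)
qed

lemma compact_closure_ball_torus: "compact (closure (ball (z :: ('n::finite) torus) r))"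
  using closed_Int_compact[OF closed_closure compact_torus] by simp

section \<open>Upper bound for separated sets in shrinking balls\<close>

text \<open>Two pairs of points in the same cell have components whose orbits stay \<epsilon>-close
  for all times below \<open>n\<close>, so separation makes the pairs equal, and it remains to count
  cells. The margin \<delta> absorbs the off-diagonal part of \<open>T\<close>; \<open>C\<close> is
  uniform in \<open>n\<close> and \<open>z\<close>.\<close>

lemma max_separated_upper:
  fixes A :: "int ^ 'n ^ 'n"
  assumes ev: "eigenvalue_listing (map_matrix of_int A) ev" and "0 \<le> \<omega>" "0 < \<delta>" "0 < \<epsilon>"
  obtains C where "C > 0"
    and "\<And>n z. real (max_separated (toral_map A) n \<epsilon> (closure (ball z (exp (- \<omega> * real n))))) \<le>
      C * (\<Prod>k\<in>UNIV. max 1 ((cmod (ev k) + \<delta>) * exp (- \<omega>)) ^ n)"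
proof -
  define M :: "complex ^ 'n ^ 'n" where "M = map_matrix of_int A"
  define L where "L = (*v) (map_matrix real_of_int A)"
  obtain P Q T rk where rk: "inj (rk :: 'n \<Rightarrow> nat)" and PQ: "P ** Q = mat 1" "Q ** P = mat 1"
    and QM: "Q ** M = T ** Q" and T: "\<And>i j. rk j < rk i \<Longrightarrow> T $ i $ j = 0" "\<And>i. T $ i $ i = ev i"
    and mono: "\<And>i j. rk i \<le> rk j \<Longrightarrow> cmod (ev i) \<le> cmod (ev j)"
    using sorted_triangularization[OF ev] unfolding M_def by metis
  obtain CT where CT: "CT > 0"
    "\<forall>j u i. cmod (((*v) T ^^ j) u $ i) \<le> CT * (\<Sum>k\<in>UNIV. (cmod (ev k) + \<delta>) ^ j * cmod (u $ k))"
    using triangular_growth[OF T rk mono \<open>0 < \<delta>\<close>] by blast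
  obtain CP where CP: "CP > 0" "\<And>v. norm (P *v v) \<le> CP * norm v"
    using linear_bounded_pos[OF linear_complex_matrix] by blast
  obtain CQ where CQ: "CQ > 0" "\<And>v. norm (Q *v v) \<le> CQ * norm v"
    using linear_bounded_pos[OF linear_complex_matrix] by blast
  define d where "d = real CARD('n)"
  have d: "d > 0" by (simp add: d_def)
  define \<mu> where "\<mu> k = cmod (ev k) + \<delta>" for k
  have \<mu>: "\<mu> k > 0" for k unfolding \<mu>_def using \<open>0 < \<delta>\<close> by (simp add: add_nonneg_pos)
  \<comment> \<open>The denominator collects the losses in \<open>small\<close>: \<open>CT\<close>
    and one \<open>d\<close> from the growth bound, another \<open>d\<close> from coordinates to the
    norm, and \<open>CP\<close> from the return to the original coordinates.\<close>
  define s0 where "s0 = \<epsilon> / (CP * d * CT * d)"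
  have s0: "s0 > 0" using \<open>0 < \<epsilon>\<close> CP CT d by (simp add: s0_def)
  \<comment> \<open>The maximum with 1 covers the coordinates with \<open>\<mu> k < 1\<close>, where
    the growth bound is largest at time 0.\<close>
  define s where "s n k = s0 / max 1 (\<mu> k) ^ n" for n k
  have s: "s n k > 0" for n k using s0 by (simp add: s_def)
  have small: "norm (((*v) M ^^ j) v) \<le> \<epsilon>"
    if u: "\<And>k. cmod ((Q *v v) $ k) \<le> s n k" and "j < n" for n v j
  proof -
    define u where "u = Q *v v"
    have "\<mu> k ^ j * cmod (u $ k) \<le> s0" for k
    proof -
      have "\<mu> k ^ j \<le> max 1 (\<mu> k) ^ j" using \<mu>[of k] by (intro power_mono) auto
      also have "\<dots> \<le> max 1 (\<mu> k) ^ n" using \<open>j < n\<close> by (intro power_increasing) auto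
      finally have "\<mu> k ^ j * cmod (u $ k) \<le> max 1 (\<mu> k) ^ n * s n k"
        using u[of k] by (intro mult_mono) (auto simp: u_def)
      then show ?thesis by (simp add: s_def max_def split: if_splits)
    qed
    then have "(\<Sum>k\<in>UNIV. \<mu> k ^ j * cmod (u $ k)) \<le> d * s0"
      using sum_mono[of UNIV "\<lambda>k. \<mu> k ^ j * cmod (u $ k)" "\<lambda>_. s0"] by (simp add: d_def)
    then have "cmod (((*v) T ^^ j) u $ i) \<le> CT * (d * s0)" for i
      using order_trans[OF CT(2)[rule_format, of j u i] mult_left_mono] CT(1) by (simp add: \<mu>_def)
    then have "norm (((*v) T ^^ j) u) \<le> d * (CT * (d * s0))" unfolding d_def by (rule norm_cvec_le_bound)
    moreover have "((*v) M ^^ j) v = P *v ((*v) T ^^ j) u"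
    proof -
      have "P *v ((*v) T ^^ j) u = P *v (Q *v ((*v) M ^^ j) v)"
        by (simp add: u_def matrix_iterate_intertwine[OF QM])
      then show ?thesis by (simp add: matrix_vector_mul_assoc PQ)
    qed
    ultimately have "norm (((*v) M ^^ j) v) \<le> CP * (d * (CT * (d * s0)))"
      using order_trans[OF CP(2) mult_left_mono] CP(1) by simp
    also have "\<dots> = \<epsilon>" using CP CT d by (simp add: s0_def)
    finally show ?thesis .
  qed
  define C where "C = (16 * CQ / s0 + 3) ^ CARD('n)"
  have C: "C > 0" unfolding C_def using CQ s0 by (intro zero_less_power add_nonneg_pos) auto
  show thesis
  proof (rule that[OF C])
    fix n and z :: "'n torus"
    define \<rho> where "\<rho> = exp (- \<omega> * real n)"
    have \<rho>: "\<rho> > 0" "\<rho> = exp (- \<omega>) ^ n" by (simp_all add: \<rho>_def mult.commute flip: exp_of_nat_mult)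
    obtain E where E: "E \<subseteq> closure (ball z \<rho>)" "finite E" "separated (toral_map A) n \<epsilon> E"
      "card E = max_separated (toral_map A) n \<epsilon> (closure (ball z \<rho>))"
      using max_separated_attained[OF continuous_toral_map compact_closure_ball_torus \<open>0 < \<epsilon>\<close>] by metis
    obtain p where p: "z = torus_of p" using torus_of_surj by metis
    \<comment> \<open>Points of the closure may lie at distance exactly \<rho>; the factor 2
      provides the strict inequality that \<open>near_torus_of\<close> requires.\<close>
    have "\<exists>x. norm x < 2 * \<rho> \<and> e = torus_of (p + x)" if "e \<in> E" for e
    proof -
      have "e \<in> cball z \<rho>" using E(1) that closure_minimal[OF ball_subset_cball closed_cball] by blast
      then have "dist e (torus_of p) < 2 * \<rho>" using \<rho>(1) by (simp add: p dist_commute)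
      then show ?thesis by (metis near_torus_of)
    qed
    then obtain x where x: "\<And>e. e \<in> E \<Longrightarrow> norm (x e) < 2 * \<rho>" "\<And>e. e \<in> E \<Longrightarrow> e = torus_of (p + x e)"
      by metis
    define u where "u e e' = Q *v complexify (x e) (x e')" for e e'
    \<comment> \<open>Cells of side \<open>s n k / 2\<close> in the real and imaginary parts keep
      the modulus of a difference within \<open>s n k\<close>.\<close>
    define \<phi> where "\<phi> e e' k = (\<lfloor>Re (u e e' $ k) / (s n k / 2)\<rfloor>, \<lfloor>Im (u e e' $ k) / (s n k / 2)\<rfloor>)" for e e' k
    \<comment> \<open>Two displacements of norm below \<open>2 * \<rho>\<close> form a complex
      vector of norm at most \<open>4 * \<rho>\<close>, and \<open>Q\<close> contributes the factor
      \<open>CQ\<close>.\<close>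
    define N where "N k = \<lceil>4 * CQ * \<rho> / (s n k / 2)\<rceil>" for k
    have in_box: "\<lfloor>t / (s n k / 2)\<rfloor> \<in> {- N k..N k}" if "\<bar>t\<bar> \<le> 4 * CQ * \<rho>" for t k
    proof -
      have "\<bar>t / (s n k / 2)\<bar> \<le> 4 * CQ * \<rho> / (s n k / 2)"
        using divide_right_mono[OF that, of "s n k / 2"] s[of n k] by simp
      then show ?thesis unfolding N_def atLeastAtMost_iff by linarith
    qed
    have u_le: "cmod (u e e' $ k) \<le> 4 * CQ * \<rho>" if "e \<in> E" "e' \<in> E" for e e' k
    proof -
      have "cmod (u e e' $ k) \<le> CQ * norm (complexify (x e) (x e'))"
        unfolding u_def by (rule order_trans[OF Finite_Cartesian_Product.norm_nth_le CQ(2)])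
      also have "\<dots> \<le> CQ * (4 * \<rho>)"
        using order_trans[OF norm_complexify(3)] x(1)[OF that(1)] x(1)[OF that(2)] CQ(1)
        by (intro mult_left_mono) (auto intro: order_trans[OF norm_complexify(3)])
      finally show ?thesis by simp
    qed
    have mem: "\<phi> e e' k \<in> {- N k..N k} \<times> {- N k..N k}" if "e \<in> E" "e' \<in> E" for e e' k
      unfolding \<phi>_def mem_Times_iff fst_conv snd_conv
      using order_trans[OF abs_Re_le_cmod u_le[OF that]] order_trans[OF abs_Im_le_cmod u_le[OF that]]
      by (intro conjI in_box)
    have inj: "inj_on (\<lambda>(e, e'). \<phi> e e') (E \<times> E)"
    proof (intro inj_onI, clarify)
      fix e e' f f' assume EE: "e \<in> E" "e' \<in> E" "f \<in> E" "f' \<in> E" and eq: "\<phi> e e' = \<phi> f f'"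
      have "cmod ((Q *v complexify (x e - x f) (x e' - x f')) $ k) \<le> s n k" for k
      proof -
        have "\<phi> e e' k = \<phi> f f' k" using eq by simp
        then have "\<bar>Re (u e e' $ k) - Re (u f f' $ k)\<bar> < s n k / 2" "\<bar>Im (u e e' $ k) - Im (u f f' $ k)\<bar> < s n k / 2"
          unfolding \<phi>_def prod.inject using s[of n k] by (intro floor_divide_eq_imp_close; simp)+
        then have "cmod (u e e' $ k - u f f' $ k) \<le> s n k"
          using cmod_le[of "u e e' $ k - u f f' $ k"] by simp
        moreover have "Q *v complexify (x e - x f) (x e' - x f') = u e e' - u f f'"
          by (simp add: u_def complexify_diff[symmetric] matrix_vector_mult_diff_distrib)
        ultimately show ?thesis by simp
      qed
      then have le: "norm (complexify ((L ^^ j) (x e - x f)) ((L ^^ j) (x e' - x f'))) \<le> \<epsilon>" if "j < n" for j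
        using small that by (metis M_def L_def complexify_iterate)
      have Lj: "norm ((L ^^ j) (x e - x f)) \<le> \<epsilon>" "norm ((L ^^ j) (x e' - x f')) \<le> \<epsilon>" if "j < n" for j
        by (rule order_trans[OF norm_complexify(1) le[OF that]], rule order_trans[OF norm_complexify(2) le[OF that]])
      \<comment> \<open>Closeness of lifts suffices, because projection to the torus does not
        increase distances.\<close>
      have same: "a = b" if ab: "a \<in> E" "b \<in> E" and near: "\<And>j. j < n \<Longrightarrow> norm ((L ^^ j) (x a - x b)) \<le> \<epsilon>" for a b
      proof (rule ccontr)
        assume "a \<noteq> b"
        then obtain j where j: "j < n" "dist ((toral_map A ^^ j) a) ((toral_map A ^^ j) b) > \<epsilon>"
          using E(3) ab unfolding separated_def by blast
        have "linear (L ^^ j)" unfolding L_def by (intro linear_iterate matrix_vector_mul_linear)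
        then have "dist ((L ^^ j) (p + x a)) ((L ^^ j) (p + x b)) = norm ((L ^^ j) (x a - x b))"
          by (simp add: dist_norm linear_add linear_diff)
        moreover have "dist ((toral_map A ^^ j) a) ((toral_map A ^^ j) b) \<le> dist ((L ^^ j) (p + x a)) ((L ^^ j) (p + x b))"
          unfolding L_def by (subst (1 2) x(2)) (auto simp: ab toral_map_iterate intro: dist_torus_of_le)
        ultimately show False using near[OF j(1)] j(2) by simp
      qed
      show "e = f \<and> e' = f'" using same[OF EE(1,3) Lj(1)] same[OF EE(2,4) Lj(2)] by simp
    qed
    have "card E \<le> (\<Prod>k\<in>UNIV. card {- N k..N k})"
      by (rule card_square_le_prod[where \<phi> = \<phi>]) (use E(2) inj mem in auto)
    then have "real (card E) \<le> (\<Prod>k\<in>UNIV. real (card {- N k..N k}))" by (metis of_nat_mono of_nat_prod)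
    also have "\<dots> \<le> (\<Prod>k\<in>UNIV. (16 * CQ / s0 + 3) * max 1 (\<mu> k * exp (- \<omega>)) ^ n)"
    proof (intro prod_mono conjI)
      fix k
      \<comment> \<open>The \<open>n\<close>-th power of the left side is
        \<open>\<rho> / s n k\<close> up to the factor \<open>s0\<close>. If
        \<open>\<mu> k \<le> 1\<close>, it is just \<open>exp (- \<omega>)\<close>, which is at most
        1.\<close>
      have "exp (- \<omega>) * max 1 (\<mu> k) \<le> max 1 (\<mu> k * exp (- \<omega>))"
        using \<open>0 \<le> \<omega>\<close> by (cases "\<mu> k \<le> 1") (auto simp: max_absorb1 max_absorb2 mult.commute intro: max.coboundedI1)
      then have le: "(exp (- \<omega>) * max 1 (\<mu> k)) ^ n \<le> max 1 (\<mu> k * exp (- \<omega>)) ^ n"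
        by (intro power_mono) auto
      have "N k \<ge> 0" using CQ(1) \<rho>(1) s[of n k] by (simp add: N_def less_imp_le le_ceiling_iff less_le_trans[of "-1" 0])
      then have "real (card {- N k..N k}) = 2 * N k + 1" by simp
      also have "\<dots> \<le> 2 * (4 * CQ * \<rho> / (s n k / 2) + 1) + 1"
        using ceiling_correct[of "4 * CQ * \<rho> / (s n k / 2)"] unfolding N_def by simp
      also have "\<dots> = 16 * CQ / s0 * (exp (- \<omega>) * max 1 (\<mu> k)) ^ n + 3"
        by (simp add: s_def \<rho>(2) power_mult_distrib)
      also have "\<dots> \<le> 16 * CQ / s0 * max 1 (\<mu> k * exp (- \<omega>)) ^ n + 3 * max 1 (\<mu> k * exp (- \<omega>)) ^ n"
        using le CQ(1) s0 by (intro add_mono mult_left_mono) auto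
      finally show "real (card {- N k..N k}) \<le> (16 * CQ / s0 + 3) * max 1 (\<mu> k * exp (- \<omega>)) ^ n"
        by (simp add: distrib_right)
    qed simp
    also have "\<dots> = C * (\<Prod>k\<in>UNIV. max 1 (\<mu> k * exp (- \<omega>)) ^ n)"
      by (simp add: prod.distrib C_def)
    finally show "real (max_separated (toral_map A) n \<epsilon> (closure (ball z (exp (- \<omega> * real n))))) \<le>
      C * (\<Prod>k\<in>UNIV. max 1 ((cmod (ev k) + \<delta>) * exp (- \<omega>)) ^ n)"
      by (simp add: E(4) \<rho>_def \<mu>_def)
  qed
qed

section \<open>Lower bound for separated sets in shrinking balls\<close>

text \<open>Each grid point gives a pair of torus points, shadowed by a pair from a maximal
  separated set. Two grid points with the same shadow would stay close for all times below
  \<open>n\<close>, which fails at the highest coordinate where they differ. The constant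
  \<open>c\<close> is uniform in \<open>n\<close> and \<open>z\<close>.\<close>

lemma max_separated_lower:
  fixes A :: "int ^ 'n ^ 'n"
  assumes ev: "eigenvalue_listing (map_matrix of_int A) ev" and "0 \<le> \<omega>"
  obtains \<epsilon>0 where "\<epsilon>0 > 0"
    and "\<And>\<epsilon>. 0 < \<epsilon> \<Longrightarrow> \<epsilon> < \<epsilon>0 \<Longrightarrow> \<exists>c>0. \<forall>n\<ge>1. \<forall>z.
      c * (\<Prod>k\<in>UNIV. max 1 (cmod (ev k) * exp (- \<omega>)) ^ n) \<le>
      real (max_separated (toral_map A) n \<epsilon> (closure (ball z (exp (- \<omega> * real n)))))"
proof -
  define M :: "complex ^ 'n ^ 'n" where "M = map_matrix of_int A"
  define L where "L = (*v) (map_matrix real_of_int A)"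
  obtain P Q T rk where rk: "inj (rk :: 'n \<Rightarrow> nat)" and PQ: "P ** Q = mat 1" "Q ** P = mat 1"
    and QM: "Q ** M = T ** Q" and T: "\<And>i j. rk j < rk i \<Longrightarrow> T $ i $ j = 0" "\<And>i. T $ i $ i = ev i"
    using sorted_triangularization[OF ev] unfolding M_def by metis
  obtain CP where CP: "CP > 0" "\<And>v. norm (P *v v) \<le> CP * norm v"
    using linear_bounded_pos[OF linear_complex_matrix] by blast
  obtain CQ where CQ: "CQ > 0" "\<And>v. norm (Q *v v) \<le> CQ * norm v"
    using linear_bounded_pos[OF linear_complex_matrix] by blast
  obtain a where a: "a > 0" "\<And>v. norm (L v) \<le> a * norm v"
    using linear_bounded_pos[OF matrix_vector_mul_linear] unfolding L_def by blast
  define d where "d = real CARD('n)"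
  have d: "d > 0" by (simp add: d_def)
  \<comment> \<open>Chosen so that grid points have displacements of norm at most
    \<open>R / 8\<close>.\<close>
  define \<rho> where "\<rho> = 1 / (16 * CP * d)"
  have \<rho>: "\<rho> > 0" using CP d by (simp add: \<rho>_def)
  show thesis
  \<comment> \<open>Below this threshold \<open>2 * \<epsilon>\<close> meets the scale condition of
    \<open>iterates_norm_le\<close>.\<close>
  proof (rule that[of "1 / (4 * a)"])
    show "1 / (4 * a) > 0" using a by simp
    fix \<epsilon> :: real assume \<epsilon>: "0 < \<epsilon>" "\<epsilon> < 1 / (4 * a)"
    then have a\<epsilon>: "a * (2 * \<epsilon>) < 1 / 2" using a(1) by (simp add: field_simps)
    \<comment> \<open>Real and imaginary parts of norm at most \<open>2 * \<epsilon>\<close> give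
      coordinates of modulus at most \<open>CQ * (4 * \<epsilon>)\<close>, which \<sigma> strictly
      exceeds.\<close>
    define \<sigma> where "\<sigma> = 4 * CQ * \<epsilon> + 1"
    have \<sigma>: "\<sigma> > 0" "CQ * (4 * \<epsilon>) < \<sigma>" using CQ \<epsilon> by (simp_all add: \<sigma>_def add_pos_pos)
    define l where "l k = max 1 (cmod (ev k))" for k
    have l: "l k \<ge> 1" for k by (simp add: l_def)
    \<comment> \<open>The factor \<open>l k\<close> appears because the grid spacing uses the
      exponent \<open>n - 1\<close>; the minimum with 1 covers coordinates where a single grid point
      has to suffice.\<close>
    define c where "c = (\<Prod>k\<in>(UNIV :: 'n set). min 1 (\<rho> / (\<sigma> * l k)))"
    have c_pos: "min 1 (\<rho> / (\<sigma> * l k)) > 0" for k using \<rho> \<sigma> l[of k] by simp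
    have "c > 0" unfolding c_def using c_pos by (intro prod_pos) auto
    moreover have "c * (\<Prod>k\<in>UNIV. max 1 (cmod (ev k) * exp (- \<omega>)) ^ n) \<le>
      real (max_separated (toral_map A) n \<epsilon> (closure (ball z (exp (- \<omega> * real n)))))"
      if n: "n \<ge> 1" for n and z :: "'n torus"
    proof -
      define R where "R = exp (- \<omega> * real n)"
      have R: "0 < R" "R \<le> 1" "R = exp (- \<omega>) ^ n"
        using \<open>0 \<le> \<omega>\<close> by (simp_all add: R_def mult.commute flip: exp_of_nat_mult)
      obtain E where E: "finite E" "card E = max_separated (toral_map A) n \<epsilon> (closure (ball z R))"
        and span: "\<And>q. q \<in> closure (ball z R) \<Longrightarrow>
          \<exists>e\<in>E. \<forall>j<n. dist ((toral_map A ^^ j) q) ((toral_map A ^^ j) e) \<le> \<epsilon>"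
        using max_separated_attained[OF continuous_toral_map compact_closure_ball_torus \<epsilon>(1)] by metis
      obtain p where p: "z = torus_of p" using torus_of_surj by metis
      \<comment> \<open>The last time seen by an \<open>n\<close>-step separated set is
        \<open>n - 1\<close>; if \<open>ev k\<close> has modulus at least 1, a gap
        \<open>s k\<close> has grown to \<sigma> exactly then.\<close>
      define s where "s k = \<sigma> / l k ^ (n - 1)" for k
      have s: "s k > 0" for k using \<sigma> l[of k] by (simp add: s_def)
      \<comment> \<open>The added 1 counts the grid index 0, so indices \<open>m\<close> below
        \<open>N k\<close> satisfy \<open>s k * m \<le> \<rho> * R\<close>.\<close>
      define N where "N k = nat \<lfloor>\<rho> * R / s k\<rfloor> + 1" for k
      define u :: "('n \<Rightarrow> nat \<times> nat) \<Rightarrow> complex ^ 'n"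
        where "u h = (\<chi> k. s k *\<^sub>R Complex (real (fst (h k))) (real (snd (h k))))" for h
      define x where "x h = (\<chi> i. Re ((P *v u h) $ i))" for h
      define y where "y h = (\<chi> i. Im ((P *v u h) $ i))" for h
      have xy: "complexify (x h) (y h) = P *v u h" for h by (simp add: x_def y_def complexify_Re_Im)
      define G where "G = PiE (UNIV :: 'n set) (\<lambda>k. {..<N k} \<times> {..<N k})"
      have xy_le: "norm (x h) \<le> R / 8" "norm (y h) \<le> R / 8" if h: "h \<in> G" for h
      proof -
        have "cmod (u h $ k) \<le> 2 * \<rho> * R" for k
        proof -
          have *: "s k * real m \<le> \<rho> * R" if "m < N k" for m
          proof -
            have "\<rho> * R / s k \<ge> 0" using \<rho> R(1) s[of k] by simp
            then have "real m \<le> \<rho> * R / s k" using that unfolding N_def by linarith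
            then show ?thesis using s[of k] by (simp add: field_simps)
          qed
          have "fst (h k) < N k" "snd (h k) < N k" using h by (auto simp: G_def PiE_iff mem_Times_iff)
          from this[THEN *] have "s k * real (fst (h k)) + s k * real (snd (h k)) \<le> 2 * \<rho> * R" by simp
          moreover have "cmod (u h $ k) \<le> s k * real (fst (h k)) + s k * real (snd (h k))"
            using s[of k] cmod_le[of "u h $ k"] by (simp add: u_def)
          ultimately show ?thesis by simp
        qed
        then have "norm (u h) \<le> d * (2 * \<rho> * R)" unfolding d_def by (rule norm_cvec_le_bound)
        then have "norm (P *v u h) \<le> CP * (d * (2 * \<rho> * R))"
          using order_trans[OF CP(2) mult_left_mono] CP(1) by simp
        also have "\<dots> = R / 8" using CP d by (simp add: \<rho>_def)
        finally show "norm (x h) \<le> R / 8" "norm (y h) \<le> R / 8"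
          using norm_complexify(1)[of "x h" "y h"] norm_complexify(2)[of "y h" "x h"] unfolding xy by linarith+
      qed
      define near where "near q e \<longleftrightarrow> e \<in> E \<and>
        (\<forall>j<n. dist ((toral_map A ^^ j) q) ((toral_map A ^^ j) e) \<le> \<epsilon>)" for q e
      have "\<exists>e. near (torus_of (p + v)) e" if "norm v \<le> R / 8" for v
      proof -
        have "dist z (torus_of (p + v)) \<le> norm v"
          using dist_torus_of_le[of p "p + v"] by (simp add: p dist_norm)
        then have "torus_of (p + v) \<in> ball z R" using that R(1) by simp
        then show ?thesis using span closure_subset unfolding near_def by blast
      qed
      \<comment> \<open>One shadowing point is fixed for each small displacement; displacements with
        equal shadows have orbits within \<open>2 * \<epsilon>\<close> of each other.\<close>
      then obtain e where e: "\<And>v. norm v \<le> R / 8 \<Longrightarrow> near (torus_of (p + v)) (e v)" by metis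
      have close: "norm ((L ^^ j) (v - w)) \<le> 2 * \<epsilon>"
        if v: "norm v \<le> R / 8" and w: "norm w \<le> R / 8" and "e v = e w" "j < n" for v w j
        unfolding L_def
      proof (rule iterates_norm_le[where p = "p + w", OF a(2)[unfolded L_def] _ a\<epsilon> _ _ \<open>j < n\<close>])
        show "a \<ge> 0" using a(1) by simp
        show "norm (v - w) < 1 / 2" using norm_triangle_ineq4[of v w] v w R(2) by linarith
        fix i assume i: "i < n"
        let ?F = "toral_map A ^^ i"
        have "dist (?F (torus_of (p + v))) (?F (e v)) \<le> \<epsilon>" "dist (?F (torus_of (p + w))) (?F (e v)) \<le> \<epsilon>"
          using e[OF v] e[OF w] \<open>e v = e w\<close> i by (auto simp: near_def)
        then have "dist (?F (torus_of (p + v))) (?F (torus_of (p + w))) \<le> 2 * \<epsilon>"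
          using dist_triangle2[of "?F (torus_of (p + v))" "?F (torus_of (p + w))" "?F (e v)"] by linarith
        then show "dist (?F (torus_of (p + w + (v - w)))) (?F (torus_of (p + w))) \<le> 2 * \<epsilon>" by simp
      qed
      have inj: "inj_on (\<lambda>h. (e (x h), e (y h))) G"
      proof (rule inj_onI, rule ccontr)
        fix h h' assume hG: "h \<in> G" "h' \<in> G" and eq: "(e (x h), e (y h)) = (e (x h'), e (y h'))"
          and "h \<noteq> h'"
        let ?D = "{k. h k \<noteq> h' k}"
        have "?D \<noteq> {}" using \<open>h \<noteq> h'\<close> by auto
        then have "Max (rk ` ?D) \<in> rk ` ?D" by (intro Max_in) auto
        \<comment> \<open>The differing coordinate of highest position is taken, so that everything
          above it cancels and \<open>triangular_iterate_top\<close> applies.\<close>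
        then obtain k where k: "h k \<noteq> h' k" "rk k = Max (rk ` ?D)" by auto
        have top: "h m = h' m" if "rk k < rk m" for m
          using that Max_ge[of "rk ` ?D" "rk m"] k(2) by fastforce
        define w where "w = u h - u h'"
        define v where "v = complexify (x h - x h') (y h - y h')"
        have w: "w = Q *v v"
          by (simp add: v_def w_def complexify_diff[symmetric] xy matrix_vector_mult_diff_distrib[symmetric]
            matrix_vector_mul_assoc PQ)
        have small: "cmod (ev k ^ j * w $ k) < \<sigma>" if j: "j < n" for j
        proof -
          have "ev k ^ j * w $ k = ((*v) T ^^ j) w $ k"
            by (subst triangular_iterate_top[OF T(1) rk]) (auto simp: T(2) w_def u_def top)
          also have "\<dots> = (Q *v ((*v) M ^^ j) v) $ k" by (simp add: w matrix_iterate_intertwine[OF QM])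
          finally have "cmod (ev k ^ j * w $ k) \<le> CQ * norm (((*v) M ^^ j) v)"
            using order_trans[OF Finite_Cartesian_Product.norm_nth_le CQ(2)] by metis
          also have "norm (((*v) M ^^ j) v) \<le> 2 * \<epsilon> + 2 * \<epsilon>"
          proof -
            have "((*v) M ^^ j) v = complexify ((L ^^ j) (x h - x h')) ((L ^^ j) (y h - y h'))"
              by (simp add: M_def v_def L_def complexify_iterate)
            moreover have "norm ((L ^^ j) (x h - x h')) \<le> 2 * \<epsilon>" "norm ((L ^^ j) (y h - y h')) \<le> 2 * \<epsilon>"
              using eq xy_le[OF hG(1)] xy_le[OF hG(2)] j by (auto intro!: close)
            ultimately show ?thesis 
              using norm_complexify(3)[of "(L ^^ j) (x h - x h')" "(L ^^ j) (y h - y h')"] by simp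
          qed
          finally show ?thesis using \<sigma>(2) CQ(1) by simp
        qed
        have w_ge: "s k \<le> cmod (w $ k)"
        proof -
          have int: "1 \<le> \<bar>real m - real m'\<bar>" if "m \<noteq> m'" for m m' :: nat using that by linarith
          have "1 \<le> \<bar>real (fst (h k)) - real (fst (h' k))\<bar> \<or> 1 \<le> \<bar>real (snd (h k)) - real (snd (h' k))\<bar>"
            using k(1) int by (metis prod_eqI)
          then have "1 \<le> cmod (Complex (real (fst (h k))) (real (snd (h k))) - Complex (real (fst (h' k))) (real (snd (h' k))))"
            (is "1 \<le> cmod ?z")
            using abs_Re_le_cmod[of ?z] abs_Im_le_cmod[of ?z] by auto
          then show ?thesis using s[of k]
            by (simp add: w_def u_def flip: scaleR_diff_right)
        qed
        \<comment> \<open>For modulus at least 1 the contradiction arises at time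
          \<open>n - 1\<close>; otherwise \<open>l k = 1\<close>, and the spacing is already
          \<sigma> at time 0.\<close>
        show False
        proof (cases "1 \<le> cmod (ev k)")
          case True
          then have "ev k \<noteq> 0" by auto
          then have "\<sigma> = cmod (ev k) ^ (n - 1) * s k"
            using True by (simp add: s_def l_def max_absorb2)
          also have "\<dots> \<le> cmod (ev k ^ (n - 1) * w $ k)"
            using w_ge by (simp add: norm_mult norm_power mult_left_mono)
          finally show False using small[of "n - 1"] n by simp
        next
          case False
          then have "s k = \<sigma>" by (simp add: s_def l_def max_def)
          then show False using small[of 0] w_ge n by simp
        qed
      qed
      have "(\<Prod>k\<in>UNIV. card {..<N k}) \<le> card E"
      proof (rule prod_le_card_square[OF E(1)])
        show "inj_on (\<lambda>h. (e (x h), e (y h))) (PiE UNIV (\<lambda>k. {..<N k} \<times> {..<N k}))"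
          using inj by (simp add: G_def)
        show "(e (x h), e (y h)) \<in> E \<times> E" if "h \<in> PiE UNIV (\<lambda>k. {..<N k} \<times> {..<N k})" for h
          using e[OF xy_le(1)] e[OF xy_le(2)] that by (simp add: G_def near_def)
      qed
      then have card: "(\<Prod>k\<in>UNIV. real (N k)) \<le> real (card E)"
        by (simp flip: of_nat_prod)
      have "c * (\<Prod>k\<in>UNIV. max 1 (cmod (ev k) * exp (- \<omega>)) ^ n) =
        (\<Prod>k\<in>UNIV. min 1 (\<rho> / (\<sigma> * l k)) * max 1 (cmod (ev k) * exp (- \<omega>)) ^ n)"
        by (simp add: c_def prod.distrib)
      also have "\<dots> \<le> (\<Prod>k\<in>UNIV. real (N k))"
      proof (intro prod_mono conjI)
        fix k
        show "0 \<le> min 1 (\<rho> / (\<sigma> * l k)) * max 1 (cmod (ev k) * exp (- \<omega>)) ^ n"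
          using c_pos[of k] by (intro mult_nonneg_nonneg) auto
        show "min 1 (\<rho> / (\<sigma> * l k)) * max 1 (cmod (ev k) * exp (- \<omega>)) ^ n \<le> real (N k)"
        proof (cases "cmod (ev k) * exp (- \<omega>) \<le> 1")
          \<comment> \<open>The coordinate does not outgrow the shrinking radius, and
            \<open>N k \<ge> 1\<close> is enough.\<close>
          case True
          then show ?thesis by (simp add: N_def max_def min_le_iff_disj)
        next
          case False
          have "cmod (ev k) * exp (- \<omega>) \<le> cmod (ev k) * 1"
            using \<open>0 \<le> \<omega>\<close> by (intro mult_left_mono) auto
          then have "1 < cmod (ev k)" using False by simp
          then have lk: "l k = cmod (ev k)" by (simp add: l_def)
          have pow: "l k ^ n = l k * l k ^ (n - 1)" using n by (cases n) auto
          have "min 1 (\<rho> / (\<sigma> * l k)) * max 1 (cmod (ev k) * exp (- \<omega>)) ^ n \<le>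
              \<rho> / (\<sigma> * l k) * (l k * exp (- \<omega>)) ^ n"
            using False by (intro mult_mono)
              (use \<rho> \<sigma>(1) in \<open>auto simp: lk intro!: divide_nonneg_nonneg mult_nonneg_nonneg\<close>)
          also have "\<dots> = \<rho> * R / s k"
            using l[of k] \<sigma>(1) by (simp add: s_def R(3) power_mult_distrib pow)
          also have "\<dots> \<le> real (N k)" unfolding N_def by linarith
          finally show ?thesis .
        qed
      qed
      also note card
      finally show ?thesis by (simp add: E(2) R_def)
    qed
    ultimately show "\<exists>c>0. \<forall>n\<ge>1. \<forall>z. c * (\<Prod>k\<in>UNIV. max 1 (cmod (ev k) * exp (- \<omega>)) ^ n) \<le>
      real (max_separated (toral_map A) n \<epsilon> (closure (ball z (exp (- \<omega> * real n)))))" by blast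
  qed
qed

section \<open>Exponential growth rates and their limits\<close>

text \<open>The maximum with 1 replaces exactly the negative terms
  \<open>ln (cmod (ev k)) - \<omega>\<close> by 0.\<close>

lemma sum_ln_max_eq:
  fixes ev :: "'n::finite \<Rightarrow> complex"
  assumes "0 \<le> \<omega>"
  shows "(\<Sum>k\<in>UNIV. ln (max 1 (cmod (ev k) * exp (- \<omega>)))) =
    (\<Sum>i | ln (cmod (ev i)) \<ge> \<omega>. ln (cmod (ev i)) - \<omega>)"
proof -
  have "ln (max 1 (cmod (ev k) * exp (- \<omega>))) = (if ln (cmod (ev k)) \<ge> \<omega> then ln (cmod (ev k)) - \<omega> else 0)" for k
  proof (cases "ev k = 0")
    \<comment> \<open>By the convention \<open>ln 0 = 0\<close> such an index belongs to the
      right-hand sum when \<open>\<omega> = 0\<close>, with contribution 0.\<close>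
    case True
    then show ?thesis using assms by simp
  next
    case False
    then have ln: "ln (cmod (ev k) * exp (- \<omega>)) = ln (cmod (ev k)) - \<omega>" by (simp add: ln_mult)
    have "1 \<le> cmod (ev k) * exp (- \<omega>) \<longleftrightarrow> 0 \<le> ln (cmod (ev k) * exp (- \<omega>))"
      using False by (subst ln_ge_zero_iff) auto
    then have "1 \<le> cmod (ev k) * exp (- \<omega>) \<longleftrightarrow> \<omega> \<le> ln (cmod (ev k))" unfolding ln by simp
    then show ?thesis using ln by (auto simp: max_def)
  qed
  then show ?thesis by (simp add: sum.If_cases)
qed

lemma ln_const_mult_prod_power:
  fixes b :: "'n::finite \<Rightarrow> real"
  assumes "c > 0" "\<And>k. b k > 0"
  shows "ln (c * (\<Prod>k\<in>UNIV. b k ^ n)) = ln c + real n * (\<Sum>k\<in>UNIV. ln (b k))"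
  using assms assms(2)[THEN less_imp_neq, symmetric]
  by (simp add: ln_mult ln_prod ln_realpow prod_pos sum_distrib_left)

lemma LIMSEQ_const_add_linear_over: "(\<lambda>n. ereal (1 / real n * (c + real n * h))) \<longlonglongrightarrow> ereal h"
proof (rule tendsto_ereal)
  have "(\<lambda>n. c * (1 / real n) + h) \<longlonglongrightarrow> c * 0 + h"
    by (intro tendsto_intros lim_1_over_n)
  then have "(\<lambda>n. c * (1 / real n) + h) \<longlonglongrightarrow> h" by simp
  then show "(\<lambda>n. 1 / real n * (c + real n * h)) \<longlonglongrightarrow> h"
  proof (rule Lim_transform_eventually)
    \<comment> \<open>The equality can fail at \<open>n = 0\<close>, where division by zero gives
      0.\<close>
    show "\<forall>\<^sub>F n in sequentially. c * (1 / real n) + h = 1 / real n * (c + real n * h)"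
      using eventually_gt_at_top[of 0] by eventually_elim (simp add: field_simps)
  qed
qed

theorem theorem2p2:
  fixes A :: "int ^ 'n ^ 'n" and ev :: "'n \<Rightarrow> complex"
    and \<omega> :: real and z :: "'n torus"
  assumes "det A = 1 \<or> det A = -1"
    and "eigenvalue_listing (map_matrix of_int A) ev"
    and "0 \<le> \<omega>"
  shows "has_translocal_entropy (toral_map A) \<omega> z
           (ereal (\<Sum>i | ln (cmod (ev i)) \<ge> \<omega>. ln (cmod (ev i)) - \<omega>))"
proof -
  define m where "m n \<epsilon> = max_separated (toral_map A) n \<epsilon> (closure (ball z (exp (- \<omega> * real n))))" for n \<epsilon>
  define a where "a \<epsilon> n = ereal (1 / real n * ln (real (m n \<epsilon>)))" for \<epsilon> n
  define h where "h \<delta> = (\<Sum>k\<in>UNIV. ln (max 1 ((cmod (ev k) + \<delta>) * exp (- \<omega>))))" for \<delta>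
  have h0: "h 0 = (\<Sum>i | ln (cmod (ev i)) \<ge> \<omega>. ln (cmod (ev i)) - \<omega>)"
    using sum_ln_max_eq[OF assms(3)] by (simp add: h_def)
  obtain \<epsilon>0 where \<epsilon>0: "\<epsilon>0 > 0" and lower: "\<And>\<epsilon>. 0 < \<epsilon> \<Longrightarrow> \<epsilon> < \<epsilon>0 \<Longrightarrow> \<exists>c>0. \<forall>n\<ge>1.
      c * (\<Prod>k\<in>UNIV. max 1 (cmod (ev k) * exp (- \<omega>)) ^ n) \<le> real (m n \<epsilon>)"
    using max_separated_lower[OF assms(2,3)] unfolding m_def by metis
  \<comment> \<open>For each fixed small \<epsilon> both limits in \<open>n\<close> already equal
    \<open>h 0\<close>; the margin \<delta> is removed before \<epsilon> tends to 0.\<close>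
  have lims: "limsup (a \<epsilon>) = h 0" "liminf (a \<epsilon>) = h 0" if \<epsilon>: "0 < \<epsilon>" "\<epsilon> < \<epsilon>0" for \<epsilon>
  proof -
    obtain c where c: "c > 0" "\<And>n. n \<ge> 1 \<Longrightarrow>
        c * (\<Prod>k\<in>UNIV. max 1 (cmod (ev k) * exp (- \<omega>)) ^ n) \<le> real (m n \<epsilon>)"
      using lower[OF \<epsilon>] by metis
    have pos: "0 < c * (\<Prod>k\<in>UNIV. max 1 (cmod (ev k) * exp (- \<omega>)) ^ n)" for n
      using c(1) by (intro mult_pos_pos prod_pos) auto
    have "liminf (\<lambda>n. ereal (1 / real n * (ln c + real n * h 0))) \<le> liminf (a \<epsilon>)"
    proof (rule Liminf_mono)
      show "\<forall>\<^sub>F n in sequentially. ereal (1 / real n * (ln c + real n * h 0)) \<le> a \<epsilon> n"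
        using eventually_ge_at_top[of 1]
      proof eventually_elim
        case (elim n)
        have "ln (c * (\<Prod>k\<in>UNIV. max 1 (cmod (ev k) * exp (- \<omega>)) ^ n)) \<le> ln (real (m n \<epsilon>))"
          using c(2)[OF elim] pos[of n] by (subst ln_le_cancel_iff) auto
        then have "ln c + real n * h 0 \<le> ln (real (m n \<epsilon>))"
          by (subst (asm) ln_const_mult_prod_power) (use c in \<open>auto simp: h_def\<close>)
        then show ?case unfolding a_def ereal_less_eq by (intro mult_left_mono) auto
      qed
    qed
    then have lo: "h 0 \<le> liminf (a \<epsilon>)"
      using lim_imp_Liminf[OF _ LIMSEQ_const_add_linear_over] by simp
    have up: "limsup (a \<epsilon>) \<le> h \<delta>" if \<delta>: "0 < \<delta>" for \<delta>
    proof -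
      obtain C where C: "C > 0" "\<And>n. real (m n \<epsilon>) \<le>
          C * (\<Prod>k\<in>UNIV. max 1 ((cmod (ev k) + \<delta>) * exp (- \<omega>)) ^ n)"
        using max_separated_upper[OF assms(2,3) \<delta> \<epsilon>(1)] unfolding m_def by metis
      have "limsup (a \<epsilon>) \<le> limsup (\<lambda>n. ereal (1 / real n * (ln C + real n * h \<delta>)))"
      proof (rule Limsup_mono)
        show "\<forall>\<^sub>F n in sequentially. a \<epsilon> n \<le> ereal (1 / real n * (ln C + real n * h \<delta>))"
          using eventually_ge_at_top[of 1]
        proof eventually_elim
          case (elim n)
          \<comment> \<open>Positivity, needed for monotonicity of \<open>ln\<close>, comes from the
            lower count.\<close>
          have "0 < real (m n \<epsilon>)" using c(2)[OF elim] pos[of n] by linarith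
          then have "ln (real (m n \<epsilon>)) \<le> ln (C * (\<Prod>k\<in>UNIV. max 1 ((cmod (ev k) + \<delta>) * exp (- \<omega>)) ^ n))"
            using C(2)[of n] by (subst ln_le_cancel_iff) auto
          also have "\<dots> = ln C + real n * h \<delta>"
            unfolding h_def by (rule ln_const_mult_prod_power) (use C in auto)
          finally show ?case unfolding a_def ereal_less_eq by (intro mult_left_mono) auto
        qed
      qed
      then show ?thesis using lim_imp_Limsup[OF _ LIMSEQ_const_add_linear_over] by simp
    qed
    \<comment> \<open>The arguments of \<open>ln\<close> in \<open>h\<close> are at least 1, so
      \<open>h\<close> is continuous and the bound \<open>h \<delta>\<close> passes to the
      limit.\<close>
    have "(h \<longlongrightarrow> h 0) (at_right 0)"
      unfolding h_def by (intro tendsto_intros) (auto simp: max_def)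
    then have "((\<lambda>\<delta>. ereal (h \<delta>)) \<longlongrightarrow> ereal (h 0)) (at_right 0)" by (rule tendsto_ereal)
    then have hi: "limsup (a \<epsilon>) \<le> h 0"
      by (rule tendsto_lowerbound) (use up in \<open>auto simp: eventually_at_filter\<close>)
    have "liminf (a \<epsilon>) \<le> limsup (a \<epsilon>)" by (rule Liminf_le_Limsup) simp
    with lo hi show "limsup (a \<epsilon>) = h 0" "liminf (a \<epsilon>) = h 0" by (auto intro: antisym order_trans)
  qed
  \<comment> \<open>As functions of \<epsilon> the upper and lower limits are eventually constant at
    the right of 0.\<close>
  have ev: "\<forall>\<^sub>F \<epsilon> in at_right 0. 0 < \<epsilon> \<and> \<epsilon> < \<epsilon>0" using \<epsilon>0 by (auto simp: eventually_at_right_field)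
  have "((\<lambda>\<epsilon>. limsup (a \<epsilon>)) \<longlongrightarrow> h 0) (at_right 0)" "((\<lambda>\<epsilon>. liminf (a \<epsilon>)) \<longlongrightarrow> h 0) (at_right 0)"
    using ev lims by (auto intro!: tendsto_eventually elim: eventually_mono)
  then show ?thesis
    unfolding has_translocal_entropy_def upper_translocal_entropy_def lower_translocal_entropy_def
      h0[symmetric] a_def[abs_def] m_def
    by (intro conjI tendsto_Lim) simp_all
qed

end
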